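(* Let $p\in(1,\infty)$ and let $B:[0,T]\times\mathbb{R}^d\times\mathcal{P}_p(\mathbb{R}^d)\to\mathbb{R}^d$ be a measurable map for which there exists $h\in L^1(0,T)$ such that $$\langle x-y,\,B_t(x,\mu)-B_t(y,\nu)\rangle\le h_t\big[|x-y|^2+|x-y|\,d_p(\mu,\nu)\big]$$ for all $t\in[0,T]$, $x,y\in\mathbb{R}^d$ and $\mu,\nu\in\mathcal{P}_p(\mathbb{R}^d)$. Then, for inputs $\mu^Y\in\mathcal{P}_p(C_T)$, pathwise uniqueness and uniqueness in law hold for the DDSDE $$X_t=\int_0^t B_s(X_s,\mathcal{L}(X_s))\,ds+Y_t,\quad t\in[0,T],\qquad\mathcal{L}(Y)=\mu^Y.$$
   Context: $T>0$ is fixed, $C_T:=C([0,T];\mathbb{R}^d)$ with supremum norm. $\mathcal{L}(Z)$ is the law of $Z$. For a separable Banach space $E$, $\mathcal{P}_p(E)$ is the set of Borel probability measures $\mu$ on $E$ with $\|\mu\|_p:=(\int\|x\|_E^p\mu(dx))^{1/p}<\infty$, with the $p$-Wasserstein distance $d_p$. Weak solution: a tuple $(\Omega,\mathcal{F},\mathbb{P};X,Y)$, $(X,Y):\Omega\to C_T\times C_T$ measurable, with (1) $\mathcal{L}(Y)=\mu^Y$; (2) $\sup_{t\in[0,T]}\|\mathcal{L}(X_t)\|_p<\infty$; (3) $\int_0^T|B_t(X_t,\mathcal{L}(X_t))|dt<\infty$ a.s.; (4) a.s. the equation holds for all $t\in[0,T]$. Uniqueness in law: any two weak solutions (possibly on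 different probability spaces) with the same input law $\mu^Y$ have the same law $\mathcal{L}(X)$ on $C_T$. Pathwise uniqueness: any two solutions on the same probability space with the same input $Y$ coincide a.s. *)

theory Defs
  imports "HOL-Probability.Probability"
begin

text \<open>
  \<open>Pp p M\<close> is $\mathcal{P}_p$ over a Borel space \<open>M\<close> carried by (a subset of) a normed space;
  integrability says that the \<open>p\<close>-th moment is finite.  The quantity \<open>pnorm\<close> is a Bochner
  integral, hence meaningful only for members of \<open>Pp\<close>.
\<close>

definition Pp :: "real \<Rightarrow> 'a::real_normed_vector measure \<Rightarrow> 'a measure set" where
  "Pp p M = {\<mu>. prob_space \<mu> \<and> sets \<mu> = sets M \<and> integrable \<mu> (\<lambda>x. norm x powr p)}"

definition pnorm :: "real \<Rightarrow> 'a::real_normed_vector measure \<Rightarrow> real" where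
  "pnorm p \<mu> = (\<integral>x. norm x powr p \<partial>\<mu>) powr (1 / p)"

definition couplings :: "'a::{banach, second_countable_topology} measure \<Rightarrow> 'a measure \<Rightarrow> ('a \<times> 'a) measure set" where
  "couplings \<mu> \<nu> = {\<pi>. prob_space \<pi> \<and> sets \<pi> = sets (borel \<Otimes>\<^sub>M borel) \<and>
     distr \<pi> borel fst = \<mu> \<and> distr \<pi> borel snd = \<nu>}"

definition wasserstein :: "real \<Rightarrow> 'a::{banach, second_countable_topology} measure \<Rightarrow> 'a measure \<Rightarrow> real" where
  "wasserstein p \<mu> \<nu> =
     enn2real (INF \<pi>\<in>couplings \<mu> \<nu>. \<integral>\<^sup>+z. ennreal (norm (fst z - snd z) powr p) \<partial>\<pi>) powr (1 / p)"

text \<open>The Borel \<open>\<sigma>\<close>-algebra of the metric space $(\mathcal{P}_p(E), d_p)$.\<close>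

definition Pp_borel :: "real \<Rightarrow> 'a::{banach, second_countable_topology} measure measure" where
  "Pp_borel p = sigma (Pp p borel)
     {U. U \<subseteq> Pp p borel \<and>
         (\<forall>\<mu>\<in>U. \<exists>e>0. \<forall>\<nu>\<in>Pp p borel. wasserstein p \<mu> \<nu> < e \<longrightarrow> \<nu> \<in> U)}"

text \<open>
  $C([0,T];E)$ is realised inside the Banach space of bounded continuous functions on the real
  line, a path being extended to the left of \<open>0\<close> and to the right of \<open>T\<close> by its end values.
  The two facts following the definition show that this is an isometric copy of $C([0,T];E)$
  with the supremum norm.
\<close>

definition CT :: "real \<Rightarrow> (real \<Rightarrow>\<^sub>C 'a::real_normed_vector) set" where
  "CT T = {f. \<forall>t. apply_bcontfun f t = apply_bcontfun f (max 0 (min T t))}"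

lemma CT_norm:
  assumes "T > 0" "f \<in> CT T"
  shows "norm f = (SUP t\<in>{0..T}. norm (apply_bcontfun f t))"
proof -
  have eq: "range (\<lambda>t. norm (apply_bcontfun f t)) = (\<lambda>t. norm (apply_bcontfun f t)) ` {0..T}"
  proof
    show "range (\<lambda>t. norm (apply_bcontfun f t)) \<subseteq> (\<lambda>t. norm (apply_bcontfun f t)) ` {0..T}"
    proof safe
      fix t
      have "apply_bcontfun f t = apply_bcontfun f (max 0 (min T t))"
        using assms(2) by (simp add: CT_def)
      moreover have "max 0 (min T t) \<in> {0..T}" using assms(1) by auto
      ultimately show "norm (apply_bcontfun f t) \<in> (\<lambda>t. norm (apply_bcontfun f t)) ` {0..T}"
        by (metis imageI)
    qed
  qed auto
  show ?thesis
    unfolding norm_bcontfun_def dist_bcontfun_def by (simp add: eq[symmetric])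
qed

lemma CT_ex1:
  fixes g :: "real \<Rightarrow> 'a::real_normed_vector"
  assumes "T > 0" "continuous_on {0..T} g"
  shows "\<exists>!f. f \<in> CT T \<and> (\<forall>t\<in>{0..T}. apply_bcontfun f t = g t)"
proof -
  define c where "c = (\<lambda>t. max 0 (min T t))"
  have c: "c t \<in> {0..T}" for t using assms(1) by (auto simp: c_def)
  have "continuous_on UNIV (\<lambda>t. g (c t))"
    by (rule continuous_on_compose2[OF assms(2)])
       (use c in \<open>auto simp: c_def intro!: continuous_intros\<close>)
  moreover have "bounded (range (\<lambda>t. g (c t)))"
    by (rule bounded_subset[OF compact_imp_bounded[OF compact_continuous_image[OF assms(2)]]])
       (use c in auto)
  ultimately have "(\<lambda>t. g (c t)) \<in> bcontfun" by (simp add: bcontfun_def)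
  then have ap: "apply_bcontfun (Bcontfun (\<lambda>t. g (c t))) = (\<lambda>t. g (c t))"
    by (simp add: Bcontfun_inverse)
  show ?thesis
  proof (rule ex1I)
    show "Bcontfun (\<lambda>t. g (c t)) \<in> CT T \<and>
      (\<forall>t\<in>{0..T}. apply_bcontfun (Bcontfun (\<lambda>t. g (c t))) t = g t)"
      unfolding CT_def mem_Collect_eq ap using assms(1) by (auto simp: c_def)
  next
    fix f assume f: "f \<in> CT T \<and> (\<forall>t\<in>{0..T}. apply_bcontfun f t = g t)"
    have "apply_bcontfun f t = g (c t)" for t
    proof -
      have "apply_bcontfun f t = apply_bcontfun f (c t)" using f by (simp add: CT_def c_def)
      then show ?thesis using f c by simp
    qed
    then show "f = Bcontfun (\<lambda>t. g (c t))" by (intro bcontfun_eqI) (simp add: ap)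
  qed
qed

definition CT_borel :: "real \<Rightarrow> (real \<Rightarrow>\<^sub>C 'a::real_normed_vector) measure" where
  "CT_borel T = restrict_space borel (CT T)"

abbreviation law_at :: "'w measure \<Rightarrow> ('w \<Rightarrow> (real \<Rightarrow>\<^sub>C 'a::real_normed_vector)) \<Rightarrow> real \<Rightarrow> 'a measure" where
  "law_at M X t \<equiv> distr M borel (\<lambda>\<omega>. apply_bcontfun (X \<omega>) t)"

text \<open>
  Weak solutions of
  $X_t = \int_0^t B_s(X_s, \mathcal{L}(X_s))\,ds + Y_t$, $t \in [0,T]$, $\mathcal{L}(Y) = \mu^Y$.
\<close>

definition weak_solution ::
  "real \<Rightarrow> real \<Rightarrow> (real \<Rightarrow> 'a::euclidean_space \<Rightarrow> 'a measure \<Rightarrow> 'a) \<Rightarrow> (real \<Rightarrow>\<^sub>C 'a) measure \<Rightarrow>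
   'w measure \<Rightarrow> ('w \<Rightarrow> (real \<Rightarrow>\<^sub>C 'a)) \<Rightarrow> ('w \<Rightarrow> (real \<Rightarrow>\<^sub>C 'a)) \<Rightarrow> bool" where
  "weak_solution T p B \<mu>Y M X Y \<longleftrightarrow>
     prob_space M \<and> X \<in> measurable M (CT_borel T) \<and> Y \<in> measurable M (CT_borel T) \<and>
     distr M (CT_borel T) Y = \<mu>Y \<and>
     (\<forall>t\<in>{0..T}. law_at M X t \<in> Pp p borel) \<and>
     bdd_above ((\<lambda>t. pnorm p (law_at M X t)) ` {0..T}) \<and>
     (AE \<omega> in M. set_integrable lborel {0..T}
        (\<lambda>t. B t (apply_bcontfun (X \<omega>) t) (law_at M X t))) \<and>
     (AE \<omega> in M. \<forall>t\<in>{0..T}. apply_bcontfun (X \<omega>) t =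
        (LINT s:{0..t}|lborel. B s (apply_bcontfun (X \<omega>) s) (law_at M X s)) +
        apply_bcontfun (Y \<omega>) t)"

text \<open>
  HOL cannot quantify over the types of the underlying sample spaces inside a formula, so these
  are explicit type arguments of the two uniqueness notions.
\<close>

definition pathwise_uniqueness ::
  "'w itself \<Rightarrow> real \<Rightarrow> real \<Rightarrow> (real \<Rightarrow> 'a::euclidean_space \<Rightarrow> 'a measure \<Rightarrow> 'a) \<Rightarrow>
   (real \<Rightarrow>\<^sub>C 'a) measure \<Rightarrow> bool" where
  "pathwise_uniqueness _ T p B \<mu>Y \<longleftrightarrow>
     (\<forall>(M :: 'w measure) X X' Y.
        weak_solution T p B \<mu>Y M X Y \<and> weak_solution T p B \<mu>Y M X' Y \<longrightarrow>
        (AE \<omega> in M. X \<omega> = X' \<omega>))"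

definition uniqueness_in_law ::
  "'w1 itself \<Rightarrow> 'w2 itself \<Rightarrow> real \<Rightarrow> real \<Rightarrow>
   (real \<Rightarrow> 'a::euclidean_space \<Rightarrow> 'a measure \<Rightarrow> 'a) \<Rightarrow> (real \<Rightarrow>\<^sub>C 'a) measure \<Rightarrow> bool" where
  "uniqueness_in_law _ _ T p B \<mu>Y \<longleftrightarrow>
     (\<forall>(M1 :: 'w1 measure) X1 Y1 (M2 :: 'w2 measure) X2 Y2.
        weak_solution T p B \<mu>Y M1 X1 Y1 \<and> weak_solution T p B \<mu>Y M2 X2 Y2 \<longrightarrow>
        distr M1 (CT_borel T) X1 = distr M2 (CT_borel T) X2)"

end

theory Submission
  imports Defs
begin

text \<open>
  Put \<open>W s\<close> for the \<open>p\<close>-Wasserstein distance of the two time-\<open>s\<close> marginals.  If the inputs agree and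
  \<open>D = X1 - X2\<close>, then \<open>|D|\<^sup>2 = 2 \<integral> D \<bullet> (b1 - b2) \<le> 2 \<integral> h (|D|\<^sup>2 + |D| W)\<close>.  On an interval on which
  \<open>\<integral> |h| \<le> 1/16\<close> and at whose left end \<open>D\<close> vanishes, a bound \<open>W \<le> m\<close> therefore forces \<open>|D| \<le> m/2\<close>
  pathwise.  As \<open>W s \<le> (E |D s|\<^sup>p)\<^sup>1\<^sup>/\<^sup>p\<close>, also \<open>W \<le> m/2\<close>, so \<open>W = 0\<close> on that interval, and finitely
  many such intervals cover \<open>[0, T]\<close>.  Both uniqueness claims then follow from the pathwise estimate.

  For solutions on different probability spaces an exact coupling of the inputs would require
  disintegration.  Instead the inputs are coupled up to an error \<open>\<epsilon>\<close>, by taking the product measure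
  conditionally on the cell of a countable partition of \<open>C([0, T])\<close>.  The error enters the energy
  identity through \<open>\<integral> (Y1 - Y2) \<bullet> (b1 - b2)\<close>, which is at most \<open>\<epsilon>\<close> times the total variation of
  \<open>(X1 - Y1) - (X2 - Y2)\<close>; this is small outside an event of small probability, which uniform
  integrability of \<open>|X s|\<^sup>p\<close> makes negligible.
\<close>

subsection \<open>Integral estimates\<close>

lemma absolutely_integrable_inner_continuous:
  fixes \<phi> g :: "real \<Rightarrow> 'a::euclidean_space"
  assumes "continuous_on {a..b} \<phi>" "g absolutely_integrable_on {a..b}"
  shows "(\<lambda>s. \<phi> s \<bullet> g s) absolutely_integrable_on {a..b}"
proof (rule absolutely_integrable_bounded_measurable_product[where h="(\<bullet>)", OF _ _ _ _ assms(2)])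
  show "bilinear ((\<bullet>) :: 'a \<Rightarrow> 'a \<Rightarrow> real)"
    by (simp add: bilinear_conv_bounded_bilinear bounded_bilinear_inner)
  show "\<phi> \<in> borel_measurable (lebesgue_on {a..b})"
    using assms(1) by (intro continuous_imp_measurable_on_sets_lebesgue) auto
  show "bounded (\<phi> ` {a..b})"
    using assms(1) by (intro compact_imp_bounded compact_continuous_image) auto
qed auto

lemma integral_inner_minus_const_le:
  fixes \<phi> g :: "real \<Rightarrow> 'a::euclidean_space"
  assumes "continuous_on {a..b} \<phi>" "g absolutely_integrable_on {a..b}"
    and "\<And>s. s \<in> {a..b} \<Longrightarrow> norm (\<phi> s - u) \<le> w"
  shows "\<bar>integral {a..b} (\<lambda>s. \<phi> s \<bullet> g s) - u \<bullet> integral {a..b} g\<bar>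
           \<le> w * integral {a..b} (\<lambda>s. norm (g s))"
proof -
  have g: "g integrable_on {a..b}" "(\<lambda>s. norm (g s)) integrable_on {a..b}"
    using assms(2) by (auto simp: absolutely_integrable_on_def)
  have i1: "(\<lambda>s. \<phi> s \<bullet> g s) integrable_on {a..b}"
    using absolutely_integrable_inner_continuous[OF assms(1,2)]
    by (simp add: absolutely_integrable_on_def)
  have i2: "((\<lambda>s. u \<bullet> g s) has_integral (u \<bullet> integral {a..b} g)) {a..b}"
    using has_integral_linear[OF integrable_integral[OF g(1)] bounded_linear_inner_right[of u]]
    by (simp add: o_def)
  have "integral {a..b} (\<lambda>s. \<phi> s \<bullet> g s) - u \<bullet> integral {a..b} g
      = integral {a..b} (\<lambda>s. (\<phi> s - u) \<bullet> g s)"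
    using i1 i2 by (simp add: inner_diff_left integral_diff has_integral_integrable_integral)
  moreover have "norm (integral {a..b} (\<lambda>s. (\<phi> s - u) \<bullet> g s))
      \<le> integral {a..b} (\<lambda>s. w * norm (g s))"
  proof (rule integral_norm_bound_integral)
    show "(\<lambda>s. (\<phi> s - u) \<bullet> g s) integrable_on {a..b}"
      using integrable_diff[OF i1 has_integral_integrable[OF i2]] by (simp add: inner_diff_left)
    show "(\<lambda>s. w * norm (g s)) integrable_on {a..b}"
      using g(2) by (rule integrable_on_mult_right)
    show "norm ((\<phi> s - u) \<bullet> g s) \<le> w * norm (g s)" if "s \<in> {a..b}" for s
      using Cauchy_Schwarz_ineq2[of "\<phi> s - u" "g s"] mult_right_mono[OF assms(3)[OF that], of "norm (g s)"]
      by simp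
  qed
  ultimately show ?thesis by simp
qed

lemma chain_le:
  fixes p :: "nat \<Rightarrow> 'a::preorder"
  assumes "\<And>i. i < n \<Longrightarrow> p i \<le> p (Suc i)"
  shows "p 0 \<le> p n"
  using assms by (induction n) (auto intro: order_trans)

text \<open>The errors of the single cells add up because \<open>\<integral>|g|\<close> is additive
  over cells. The representatives \<open>u i\<close> need not be values of \<open>\<phi>\<close>:
  the energy identity takes sums of two endpoint values, the variation bound takes left endpoint
  values.\<close>

lemma riemann_sum_error:
  fixes \<phi> g :: "real \<Rightarrow> 'a::euclidean_space" and u :: "nat \<Rightarrow> 'a"
  assumes "continuous_on {p 0..p n} \<phi>" "g absolutely_integrable_on {p 0..p n}"
    and "\<And>i. i < n \<Longrightarrow> p i \<le> p (Suc i)"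
    and "\<And>i s. i < n \<Longrightarrow> s \<in> {p i..p (Suc i)} \<Longrightarrow> norm (\<phi> s - u i) \<le> w"
  shows "\<bar>integral {p 0..p n} (\<lambda>s. \<phi> s \<bullet> g s) -
            (\<Sum>i<n. u i \<bullet> integral {p i..p (Suc i)} g)\<bar>
           \<le> w * integral {p 0..p n} (\<lambda>s. norm (g s))"
  using assms
proof (induction n)
  case 0
  then show ?case by simp
next
  case (Suc n)
  have n0: "p 0 \<le> p n"
    using Suc.prems(3) by (intro chain_le) auto
  have nn: "p n \<le> p (Suc n)" using Suc.prems(3) by simp
  note sub = absolutely_integrable_on_subinterval[OF Suc.prems(2)]
  have c1: "continuous_on {p 0..p n} \<phi>" and c2: "continuous_on {p n..p (Suc n)} \<phi>"
    by (rule continuous_on_subset[OF Suc.prems(1)]; use n0 nn in auto)+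
  have g1: "g absolutely_integrable_on {p 0..p n}" and g2: "g absolutely_integrable_on {p n..p (Suc n)}"
    by (rule sub; use n0 nn in auto)+
  have "\<bar>integral {p 0..p n} (\<lambda>s. \<phi> s \<bullet> g s) - (\<Sum>i<n. u i \<bullet> integral {p i..p (Suc i)} g)\<bar>
      \<le> w * integral {p 0..p n} (\<lambda>s. norm (g s))"
    using Suc.IH[OF c1 g1] Suc.prems(3,4) by auto
  moreover have "\<bar>integral {p n..p (Suc n)} (\<lambda>s. \<phi> s \<bullet> g s) - u n \<bullet> integral {p n..p (Suc n)} g\<bar>
      \<le> w * integral {p n..p (Suc n)} (\<lambda>s. norm (g s))"
    using Suc.prems(4) by (intro integral_inner_minus_const_le c2 g2) auto
  moreover have "integral {p 0..p n} (\<lambda>s. \<phi> s \<bullet> g s) + integral {p n..p (Suc n)} (\<lambda>s. \<phi> s \<bullet> g s)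
      = integral {p 0..p (Suc n)} (\<lambda>s. \<phi> s \<bullet> g s)"
    using absolutely_integrable_inner_continuous[OF Suc.prems(1,2)]
    by (intro Henstock_Kurzweil_Integration.integral_combine n0 nn) (simp add: absolutely_integrable_on_def)
  moreover have "integral {p 0..p n} (\<lambda>s. norm (g s)) + integral {p n..p (Suc n)} (\<lambda>s. norm (g s))
      = integral {p 0..p (Suc n)} (\<lambda>s. norm (g s))"
    using Suc.prems(2)
    by (intro Henstock_Kurzweil_Integration.integral_combine n0 nn) (simp add: absolutely_integrable_on_def)
  ultimately show ?case
    unfolding sum.lessThan_Suc by (smt (verit) distrib_left)
qed

lemma uniform_partition:
  assumes "0 \<le> t" "0 < (n::nat)"
  shows "\<And>i. t * real i / n \<le> t * real (Suc i) / n" and "t * real n / n = t" "t * real 0 / n = 0"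
    and "\<And>i s. i < n \<Longrightarrow> s \<in> {t * real i / n..t * real (Suc i) / n} \<Longrightarrow>
      s \<in> {0..t} \<and> \<bar>s - t * real i / n\<bar> \<le> t / n \<and> \<bar>s - t * real (Suc i) / n\<bar> \<le> t / n"
proof -
  show "t * real i / n \<le> t * real (Suc i) / n" for i
    using assms by (intro divide_right_mono mult_left_mono) auto
  show "t * real n / n = t" "t * real 0 / n = 0" using assms by auto
  fix i s assume i: "i < n" "s \<in> {t * real i / n..t * real (Suc i) / n}"
  have 1: "0 \<le> t * real i / n" using assms by simp
  have "t * real (Suc i) / n \<le> t * real n / n"
    using assms i(1) by (intro divide_right_mono mult_left_mono) auto
  also have "\<dots> = t" using assms by simp
  finally have 2: "t * real (Suc i) / n \<le> t" .
  have "t * real (Suc i) / n = t * real i / n + t / n" by (simp add: field_simps add_divide_distrib)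
  then show "s \<in> {0..t} \<and> \<bar>s - t * real i / n\<bar> \<le> t / n \<and> \<bar>s - t * real (Suc i) / n\<bar> \<le> t / n"
    using 1 2 i(2) by auto
qed

lemma exists_fine_partition:
  fixes \<phi> :: "real \<Rightarrow> 'a::metric_space"
  assumes "0 \<le> t" "continuous_on {0..t} \<phi>" "0 < d"
  obtains n :: nat where "0 < n"
    "\<And>x y. x \<in> {0..t} \<Longrightarrow> y \<in> {0..t} \<Longrightarrow> \<bar>x - y\<bar> \<le> t / n \<Longrightarrow> dist (\<phi> x) (\<phi> y) \<le> d"
proof -
  have "uniformly_continuous_on {0..t} \<phi>"
    using assms by (intro compact_uniformly_continuous) auto
  then obtain e where e: "e > 0" "\<And>x y. x \<in> {0..t} \<Longrightarrow> y \<in> {0..t} \<Longrightarrow> dist x y < e \<Longrightarrow> dist (\<phi> x) (\<phi> y) < d"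
    using assms(3) by (metis uniformly_continuous_on_def)
  obtain n :: nat where n: "t / e < n" using reals_Archimedean2 by blast
  have n0: "0 < n"
    using n divide_nonneg_pos[OF assms(1) e(1)] by (cases n) auto
  have "t / n < e" using n e(1) n0 by (simp add: field_simps)
  show thesis
  proof (rule that[OF n0])
    fix x y assume "x \<in> {0..t}" "y \<in> {0..t}" "\<bar>x - y\<bar> \<le> t / n"
    then show "dist (\<phi> x) (\<phi> y) \<le> d"
      using e(2)[of x y] \<open>t / n < e\<close> by (simp add: dist_real_def)
  qed
qed

lemma le_from_arbitrary_slope:
  fixes a b K :: real
  assumes "\<And>d. 0 < d \<Longrightarrow> a \<le> b + d * K" "0 \<le> K"
  shows "a \<le> b"
proof (rule field_le_epsilon)
  fix e :: real assume "0 < e"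
  have "a \<le> b + e / (K + 1) * K" using assms(2) \<open>0 < e\<close> by (intro assms(1)) auto
  also have "e / (K + 1) * K \<le> e" using assms(2) \<open>0 < e\<close> by (simp add: field_simps)
  finally show "a \<le> b + e" by simp
qed

text \<open>For a merely integrable \<open>g\<close> the chain rule for \<open>|G|\<^sup>2\<close>
  comes from telescoping: \<open>|b|\<^sup>2 - |a|\<^sup>2 = (a + b) \<bullet> (b - a)\<close>, and
  on a fine partition the sum of the two endpoint values of \<open>G\<close> is close to
  \<open>2 G\<close>.\<close>

lemma norm_indefinite_integral_sq:
  fixes g :: "real \<Rightarrow> 'a::euclidean_space"
  assumes "0 \<le> t" "g absolutely_integrable_on {0..t}"
  defines "G \<equiv> \<lambda>s. integral {0..s} g"
  shows "(norm (G t))\<^sup>2 = 2 * integral {0..t} (\<lambda>s. G s \<bullet> g s)"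
proof -
  have gi: "g integrable_on {0..t}" using assms(2) by (simp add: absolutely_integrable_on_def)
  have cG: "continuous_on {0..t} G" unfolding G_def using gi by (rule indefinite_integral_continuous_1)
  have K: "0 \<le> integral {0..t} (\<lambda>s. norm (g s))"
    using assms(2) by (intro integral_nonneg) (auto simp: absolutely_integrable_on_def)
  have main: "\<bar>integral {0..t} (\<lambda>s. (2 *\<^sub>R G s) \<bullet> g s) - (norm (G t))\<^sup>2\<bar> \<le> 0 + d * (2 * integral {0..t} (\<lambda>s. norm (g s)))"
    if d: "0 < d" for d
  proof -
    obtain n :: nat where n: "0 < n" "\<And>x y. x \<in> {0..t} \<Longrightarrow> y \<in> {0..t} \<Longrightarrow> \<bar>x - y\<bar> \<le> t / n \<Longrightarrow> dist (G x) (G y) \<le> d"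
      using exists_fine_partition[OF assms(1) cG d] by blast
    define p where "p i = t * real i / n" for i
    note up = uniform_partition[OF assms(1) n(1), folded p_def]
    have pm: "p i \<in> {0..t}" "p (Suc i) \<in> {0..t}" if "i < n" for i
      using up(4)[OF that] up(1)[of i] by auto
    have comb: "integral {p i..p (Suc i)} g = G (p (Suc i)) - G (p i)" if "i < n" for i
      unfolding G_def using pm[OF that] up(1)[of i] integrable_subinterval_real[OF gi, of 0 "p (Suc i)"]
        Henstock_Kurzweil_Integration.integral_combine[of 0 "p i" "p (Suc i)" g]
      by (simp add: algebra_simps)
    \<comment> \<open>Using both endpoints makes the sum telescope exactly; each of them is within
      \<open>d\<close> of \<open>G s\<close>, whence \<open>2 * d\<close>.\<close>
    have "\<bar>integral {p 0..p n} (\<lambda>s. (2 *\<^sub>R G s) \<bullet> g s) -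
            (\<Sum>i<n. (G (p i) + G (p (Suc i))) \<bullet> integral {p i..p (Suc i)} g)\<bar>
           \<le> (2 * d) * integral {p 0..p n} (\<lambda>s. norm (g s))"
    proof (rule riemann_sum_error)
      show "continuous_on {p 0..p n} (\<lambda>s. 2 *\<^sub>R G s)"
        using cG up(2,3) by (auto intro!: continuous_intros)
      show "norm (2 *\<^sub>R G s - (G (p i) + G (p (Suc i)))) \<le> 2 * d" if "i < n" "s \<in> {p i..p (Suc i)}" for i s
      proof -
        have "2 *\<^sub>R G s - (G (p i) + G (p (Suc i))) = (G s - G (p i)) + (G s - G (p (Suc i)))"
          by (simp add: scaleR_2)
        then have "norm (2 *\<^sub>R G s - (G (p i) + G (p (Suc i)))) \<le> dist (G s) (G (p i)) + dist (G s) (G (p (Suc i)))"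
          by (metis dist_norm norm_triangle_ineq)
        moreover have "dist (G s) (G (p i)) \<le> d" "dist (G s) (G (p (Suc i))) \<le> d"
          using up(4)[OF that] pm[OF that(1)] by (auto intro!: n(2))
        ultimately show ?thesis by simp
      qed
    qed (use up assms(2) in auto)
    moreover have "(\<Sum>i<n. (G (p i) + G (p (Suc i))) \<bullet> integral {p i..p (Suc i)} g)
        = (\<Sum>i<n. (norm (G (p (Suc i))))\<^sup>2 - (norm (G (p i)))\<^sup>2)"
    proof (rule sum.cong)
      fix i assume "i \<in> {..<n}"
      then show "(G (p i) + G (p (Suc i))) \<bullet> integral {p i..p (Suc i)} g
          = (norm (G (p (Suc i))))\<^sup>2 - (norm (G (p i)))\<^sup>2"
        using inner_commute[of "G (p i)" "G (p (Suc i))"]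
        by (simp add: comb power2_norm_eq_inner inner_add_left inner_diff_right)
    qed simp
    moreover have "\<dots> = (norm (G t))\<^sup>2"
      unfolding sum_lessThan_telescope[of "\<lambda>i. (norm (G (p i)))\<^sup>2"] up(2,3) by (simp add: G_def)
    ultimately show ?thesis unfolding up(2,3) by (simp only: mult_ac add_0)
  qed
  have "\<bar>integral {0..t} (\<lambda>s. (2 *\<^sub>R G s) \<bullet> g s) - (norm (G t))\<^sup>2\<bar> \<le> 0"
    using K by (intro le_from_arbitrary_slope[OF main]) simp_all
  then have "integral {0..t} (\<lambda>s. (2 *\<^sub>R G s) \<bullet> g s) = (norm (G t))\<^sup>2" by linarith
  then show ?thesis unfolding inner_scaleR_left by (metis integral_mult_right)
qed

text \<open>Uniform partitions suffice: their mesh becomes arbitrarily fine, as Riemann sums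
  require, and for fixed \<open>n\<close> and continuous \<open>F\<close> the sum is continuous in
  \<open>t\<close>, so that rational times control all times.\<close>

definition variation_sum :: "nat \<Rightarrow> real \<Rightarrow> (real \<Rightarrow> 'a::real_normed_vector) \<Rightarrow> real" where
  "variation_sum n t F = (\<Sum>i<n. norm (F (t * real (Suc i) / n) - F (t * real i / n)))"

text \<open>Riemann sums with left endpoint values of \<open>e\<close> are at most \<epsilon> times
  the variation sums of the indefinite integral; the term with \<open>\<integral>|g|\<close>
  vanishes with the mesh. For a solution the indefinite integral of the drift is
  \<open>X - Y\<close>, so this bound refers to the paths alone.\<close>

lemma integral_inner_le_variation:
  fixes g e :: "real \<Rightarrow> 'a::euclidean_space"
  assumes "0 \<le> t" "g absolutely_integrable_on {0..t}" "continuous_on {0..t} e"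
    and "\<And>s. s \<in> {0..t} \<Longrightarrow> norm (e s) \<le> \<epsilon>"
    and "\<And>n. variation_sum n t (\<lambda>s. integral {0..s} g) \<le> R"
  shows "\<bar>integral {0..t} (\<lambda>s. e s \<bullet> g s)\<bar> \<le> \<epsilon> * R"
proof -
  define G where "G = (\<lambda>s. integral {0..s} g)"
  have gi: "g integrable_on {0..t}" using assms(2) by (simp add: absolutely_integrable_on_def)
  have K: "0 \<le> integral {0..t} (\<lambda>s. norm (g s))"
    using assms(2) by (intro integral_nonneg) (auto simp: absolutely_integrable_on_def)
  have \<epsilon>: "0 \<le> \<epsilon>" using assms(4)[of 0] assms(1) norm_ge_zero[of "e 0"] by (simp del: norm_ge_zero)
  show ?thesis
  proof (rule le_from_arbitrary_slope[OF _ K])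
    fix d :: real assume d: "0 < d"
    obtain n :: nat where n: "0 < n" "\<And>x y. x \<in> {0..t} \<Longrightarrow> y \<in> {0..t} \<Longrightarrow> \<bar>x - y\<bar> \<le> t / n \<Longrightarrow> dist (e x) (e y) \<le> d"
      using exists_fine_partition[OF assms(1,3) d] by blast
    define p where "p i = t * real i / n" for i
    note up = uniform_partition[OF assms(1) n(1), folded p_def]
    have pm: "p i \<in> {0..t}" "p (Suc i) \<in> {0..t}" if "i < n" for i
      using up(4)[OF that] up(1)[of i] by auto
    have comb: "integral {p i..p (Suc i)} g = G (p (Suc i)) - G (p i)" if "i < n" for i
      unfolding G_def using pm[OF that] up(1)[of i] integrable_subinterval_real[OF gi, of 0 "p (Suc i)"]
        Henstock_Kurzweil_Integration.integral_combine[of 0 "p i" "p (Suc i)" g]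
      by (simp add: algebra_simps)
    have "\<bar>integral {p 0..p n} (\<lambda>s. e s \<bullet> g s) -
            (\<Sum>i<n. e (p i) \<bullet> integral {p i..p (Suc i)} g)\<bar>
           \<le> d * integral {p 0..p n} (\<lambda>s. norm (g s))"
    proof (rule riemann_sum_error)
      show "norm (e s - e (p i)) \<le> d" if "i < n" "s \<in> {p i..p (Suc i)}" for i s
        using up(4)[OF that] pm[OF that(1)] n(2)[of s "p i"] by (auto simp: dist_norm)
    qed (use up assms in auto)
    moreover have "\<bar>\<Sum>i<n. e (p i) \<bullet> integral {p i..p (Suc i)} g\<bar> \<le> \<epsilon> * R"
    proof -
      have "\<bar>\<Sum>i<n. e (p i) \<bullet> integral {p i..p (Suc i)} g\<bar> \<le> (\<Sum>i<n. \<bar>e (p i) \<bullet> integral {p i..p (Suc i)} g\<bar>)"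
        by (rule sum_abs)
      also have "\<dots> \<le> (\<Sum>i<n. \<epsilon> * norm (G (p (Suc i)) - G (p i)))"
      proof (rule sum_mono)
        fix i assume "i \<in> {..<n}"
        then have i: "i < n" by simp
        have "\<bar>e (p i) \<bullet> (G (p (Suc i)) - G (p i))\<bar> \<le> norm (e (p i)) * norm (G (p (Suc i)) - G (p i))"
          by (rule Cauchy_Schwarz_ineq2)
        also have "\<dots> \<le> \<epsilon> * norm (G (p (Suc i)) - G (p i))"
          using assms(4)[OF pm(1)[OF i]] by (intro mult_right_mono) auto
        finally show "\<bar>e (p i) \<bullet> integral {p i..p (Suc i)} g\<bar> \<le> \<epsilon> * norm (G (p (Suc i)) - G (p i))"
          by (simp add: comb[OF i])
      qed
      also have "\<dots> = \<epsilon> * variation_sum n t G"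
        by (simp add: variation_sum_def sum_distrib_left p_def)
      also have "\<dots> \<le> \<epsilon> * R" using assms(5) \<epsilon> by (intro mult_left_mono) (auto simp: G_def)
      finally show ?thesis .
    qed
    ultimately show "\<bar>integral {0..t} (\<lambda>s. e s \<bullet> g s)\<bar> \<le> \<epsilon> * R + d * integral {0..t} (\<lambda>s. norm (g s))"
      unfolding up(2,3) by arith
  qed
qed


text \<open>\<open>D\<close> stands for the difference of two solution paths, \<open>e\<close> for
  that of their inputs and \<open>g\<close> for that of their drifts. The scale \<sigma> absorbs
  both effects of the input error: the sup bound \<epsilon> of \<open>e\<close>, and the error
  \<open>4 * (\<epsilon> * R)\<close> in the energy identity.\<close>

locale perturbed_integral =
  fixes T \<epsilon> R \<sigma> :: real and g e D :: "real \<Rightarrow> 'a::euclidean_space" and k :: "real \<Rightarrow> real"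
  assumes g: "g absolutely_integrable_on {0..T}"
    and e: "continuous_on {0..T} e" "\<And>s. s \<in> {0..T} \<Longrightarrow> norm (e s) \<le> \<epsilon>"
    and D: "\<And>s. s \<in> {0..T} \<Longrightarrow> D s = integral {0..s} g + e s"
    and variation: "\<And>n t. t \<in> {0..T} \<Longrightarrow> variation_sum n t (\<lambda>s. integral {0..s} g) \<le> R"
    and k: "k integrable_on {0..T}" "\<And>s. s \<in> {0..T} \<Longrightarrow> 0 \<le> k s"
    and \<sigma>: "0 \<le> \<sigma>" "\<epsilon> \<le> \<sigma>" "4 * (\<epsilon> * R) \<le> \<sigma>\<^sup>2"
begin

lemma continuous_D: "continuous_on {0..T} D"
proof -
  have "continuous_on {0..T} (\<lambda>s. integral {0..s} g)"
    using g by (intro indefinite_integral_continuous_1) (simp add: absolutely_integrable_on_def)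
  then have "continuous_on {0..T} (\<lambda>s. integral {0..s} g + e s)"
    using e(1) by (rule continuous_on_add)
  then show ?thesis by (rule continuous_on_eq) (simp add: D)
qed

text \<open>Let \<open>S\<close> be the maximum of \<open>norm (D s)\<close> on
  \<open>{a..b}\<close>, attained at \<open>r\<close>. The energy identity between \<open>a\<close>
  and \<open>r\<close> bounds the growth of the squared norm by
  \<open>(S\<^sup>2 + S * m) / 8\<close> plus the input error. Taking roots leaves
  \<open>S / 2\<close> on the right, which is absorbed on the left.\<close>

lemma norm_step:
  assumes ab: "0 \<le> a" "a \<le> b" "b \<le> T"
    and small: "integral {a..b} k \<le> 1 / 16"
    and m: "0 \<le> m" "\<And>s. s \<in> {a..b} \<Longrightarrow> D s \<bullet> g s \<le> k s * ((norm (D s))\<^sup>2 + norm (D s) * m)"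
    and t: "t \<in> {a..b}"
  shows "norm (D t) \<le> m / 2 + 2 * norm (D a) + 6 * \<sigma>"
proof -
  \<comment> \<open>The energy identity is written for \<open>G = D - e\<close>: the chain rule
    applies to indefinite integrals, whereas \<open>e\<close> is only continuous.\<close>
  define G where "G = (\<lambda>s. integral {0..s} g)"
  have "continuous_on {a..b} (\<lambda>s. norm (D s))"
    using continuous_on_subset[OF continuous_D, of "{a..b}"] ab by (auto intro!: continuous_intros)
  then obtain r where r: "r \<in> {a..b}" "\<And>s. s \<in> {a..b} \<Longrightarrow> norm (D s) \<le> norm (D r)"
    using continuous_attains_sup[of "{a..b}" "\<lambda>s. norm (D s)"] ab by auto
  define S where "S = norm (D r)"
  have S: "0 \<le> S" "\<And>s. s \<in> {a..b} \<Longrightarrow> norm (D s) \<le> S" using r by (auto simp: S_def)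
  have r0: "0 \<le> r" "r \<le> T" using r ab by auto
  then have ra: "r \<in> {0..T}" "a \<in> {0..T}" using ab by auto
  have gs: "g absolutely_integrable_on {0..s}" if "s \<in> {0..T}" for s
    using that by (intro absolutely_integrable_on_subinterval[OF g]) auto
  have energy: "(norm (G s))\<^sup>2 = 2 * integral {0..s} (\<lambda>u. D u \<bullet> g u) - 2 * integral {0..s} (\<lambda>u. e u \<bullet> g u)"
    if s: "s \<in> {0..T}" for s
  proof -
    have i: "(\<lambda>u. D u \<bullet> g u) integrable_on {0..s}" "(\<lambda>u. e u \<bullet> g u) integrable_on {0..s}"
      using absolutely_integrable_inner_continuous[OF continuous_on_subset[OF continuous_D] gs[OF s]]
        absolutely_integrable_inner_continuous[OF continuous_on_subset[OF e(1)] gs[OF s]] s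
      by (auto simp: absolutely_integrable_on_def)
    have "integral {0..s} (\<lambda>u. G u \<bullet> g u) = integral {0..s} (\<lambda>u. D u \<bullet> g u - e u \<bullet> g u)"
      using s D by (intro Henstock_Kurzweil_Integration.integral_cong) (auto simp: G_def inner_add_left)
    also have "\<dots> = integral {0..s} (\<lambda>u. D u \<bullet> g u) - integral {0..s} (\<lambda>u. e u \<bullet> g u)"
      using i by (rule Henstock_Kurzweil_Integration.integral_diff)
    finally show ?thesis
      using norm_indefinite_integral_sq[OF _ gs[OF s]] s by (simp add: G_def)
  qed
  have err: "\<bar>integral {0..s} (\<lambda>u. e u \<bullet> g u)\<bar> \<le> \<epsilon> * R" if s: "s \<in> {0..T}" for s
    using s variation[OF s] e
    by (intro integral_inner_le_variation gs) (auto intro: continuous_on_subset)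
  have Dg: "(\<lambda>u. D u \<bullet> g u) integrable_on {0..r}" "(\<lambda>u. D u \<bullet> g u) integrable_on {a..r}"
  proof -
    show "(\<lambda>u. D u \<bullet> g u) integrable_on {0..r}"
      using absolutely_integrable_inner_continuous[OF continuous_on_subset[OF continuous_D] gs[of r]] r0
      by (auto simp: absolutely_integrable_on_def)
    then show "(\<lambda>u. D u \<bullet> g u) integrable_on {a..r}"
      by (rule integrable_subinterval_real) (use ab r in auto)
  qed
  have comb: "integral {0..a} (\<lambda>u. D u \<bullet> g u) + integral {a..r} (\<lambda>u. D u \<bullet> g u) = integral {0..r} (\<lambda>u. D u \<bullet> g u)"
    using Dg ab r by (intro Henstock_Kurzweil_Integration.integral_combine) auto
  have "integral {a..r} (\<lambda>u. D u \<bullet> g u) \<le> integral {a..r} (\<lambda>u. k u * (S\<^sup>2 + S * m))"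
  proof (rule integral_le)
    show "(\<lambda>u. D u \<bullet> g u) integrable_on {a..r}" by (rule Dg)
    show "(\<lambda>u. k u * (S\<^sup>2 + S * m)) integrable_on {a..r}"
      using integrable_subinterval_real[OF k(1), of a r] ab r by (intro integrable_on_mult_left) auto
    show "D u \<bullet> g u \<le> k u * (S\<^sup>2 + S * m)" if u: "u \<in> {a..r}" for u
    proof -
      have u': "u \<in> {a..b}" "u \<in> {0..T}" using u r ab by auto
      have "(norm (D u))\<^sup>2 + norm (D u) * m \<le> S\<^sup>2 + S * m"
        using S(2)[OF u'(1)] m(1) by (intro add_mono power_mono mult_right_mono) auto
      then show ?thesis using m(2)[OF u'(1)] mult_left_mono[OF _ k(2)[OF u'(2)]] by (meson order_trans)
    qed
  qed
  also have "\<dots> = integral {a..r} k * (S\<^sup>2 + S * m)" by simp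
  also have "\<dots> \<le> 1 / 16 * (S\<^sup>2 + S * m)"
  proof (intro mult_right_mono)
    have "integral {a..r} k \<le> integral {a..b} k"
      using ab r k integrable_subinterval_real[OF k(1), of a b] integrable_subinterval_real[OF k(1), of a r]
      by (intro integral_subset_le) auto
    then show "integral {a..r} k \<le> 1 / 16" using small by simp
  qed (use S m in auto)
  finally have "2 * integral {a..r} (\<lambda>u. D u \<bullet> g u) \<le> (S\<^sup>2 + S * m) / 8" by simp
  \<comment> \<open>The input errors up to \<open>r\<close> and up to \<open>a\<close> contribute
    \<open>2 * (\<epsilon> * R)\<close> each; this is the use of
    \<open>4 * (\<epsilon> * R) \<le> \<sigma>\<^sup>2\<close>.\<close>
  then have "(norm (G r))\<^sup>2 \<le> (norm (G a))\<^sup>2 + (S\<^sup>2 + S * m) / 8 + \<sigma>\<^sup>2"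
    using energy[OF ra(1)] energy[OF ra(2)] abs_le_D2[OF err[OF ra(1)]] abs_le_D1[OF err[OF ra(2)]] \<sigma>(3) comb
    by linarith
  also have "\<dots> \<le> (norm (G a))\<^sup>2 + ((S + m / 2) / 2)\<^sup>2 + \<sigma>\<^sup>2"
  proof -
    have "0 \<le> S * m" using S m by simp
    then show ?thesis by (simp add: power2_eq_square field_simps)
  qed
  also have "\<dots> \<le> (norm (G a) + (S + m / 2) / 2 + \<sigma>)\<^sup>2"
  proof -
    have "x\<^sup>2 + y\<^sup>2 + z\<^sup>2 \<le> (x + y + z)\<^sup>2" if "0 \<le> x" "0 \<le> y" "0 \<le> z" for x y z :: real
      using mult_nonneg_nonneg[OF that(1,2)] mult_nonneg_nonneg[OF that(1,3)] mult_nonneg_nonneg[OF that(2,3)]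
      by (simp add: power2_eq_square algebra_simps)
    then show ?thesis using S(1) m(1) \<sigma>(1) by simp
  qed
  finally have "norm (G r) \<le> norm (G a) + (S + m / 2) / 2 + \<sigma>"
    by (rule power2_le_imp_le) (use S(1) m(1) \<sigma>(1) in auto)
  moreover have "S \<le> norm (G r) + \<epsilon>"
    unfolding S_def using D[of r] e(2)[of r] r0 norm_triangle_ineq[of "G r" "e r"] by (auto simp: G_def)
  moreover have "norm (G a) \<le> norm (D a) + \<epsilon>"
    using D[of a] e(2)[of a] ab norm_triangle_ineq4[of "D a" "e a"] by (auto simp: G_def)
  \<comment> \<open>Passing from \<open>G\<close> to \<open>D\<close> at \<open>r\<close> and at
    \<open>a\<close> costs \<epsilon> each. With the \<sigma> already present this is at most
    \<open>3 * \<sigma>\<close>, doubled when \<open>S / 2\<close> is absorbed.\<close>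
  ultimately have "S \<le> m / 2 + 2 * norm (D a) + 6 * \<sigma>" using \<sigma>(2) by argo
  then show ?thesis using S(2)[OF t] by simp
qed

text \<open>Iterates \<open>norm_step\<close> with \<open>m = 0\<close>, starting from
  \<open>D 0 = e 0\<close>. One step turns \<open>8 ^ j * \<sigma>\<close> into
  \<open>2 * (8 ^ j * \<sigma>) + 6 * \<sigma>\<close>, and
  \<open>6 * \<sigma> \<le> 6 * (8 ^ j * \<sigma>)\<close>; this explains the base 8.\<close>

lemma norm_grid:
  fixes q :: "nat \<Rightarrow> real"
  assumes q: "q 0 = 0" "mono q" "\<And>i. i \<le> j \<Longrightarrow> q i \<le> T"
    and small: "\<And>i. i < j \<Longrightarrow> integral {q i..q (Suc i)} k \<le> 1 / 16"
    and diss: "\<And>s. s \<in> {0..q j} \<Longrightarrow> D s \<bullet> g s \<le> k s * (norm (D s))\<^sup>2"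
  shows "\<forall>s\<in>{0..q j}. norm (D s) \<le> 8 ^ j * \<sigma>"
  using q(3) small diss
proof (induction j)
  case 0
  then have "0 \<in> {0..T}" using q(1) by (metis atLeastAtMost_iff le0 order_refl)
  then show ?case using D[of 0] e(2)[of 0] \<sigma>(2) q(1) by auto
next
  case (Suc j)
  have qm: "0 \<le> q j" "q j \<le> q (Suc j)" using q(1,2) by (metis monoD le0, simp add: monoD)
  have IH: "\<forall>s\<in>{0..q j}. norm (D s) \<le> 8 ^ j * \<sigma>"
    using Suc.prems qm by (intro Suc.IH) auto
  have *: "2 * (8 ^ j * \<sigma>) + 6 * \<sigma> \<le> 8 ^ Suc j * \<sigma>"
    using \<sigma>(1) mult_right_mono[of 1 "8 ^ j" \<sigma>] by (simp add: mult.commute)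
  show ?case
  proof
    fix s assume s: "s \<in> {0..q (Suc j)}"
    show "norm (D s) \<le> 8 ^ Suc j * \<sigma>"
    proof (cases "s \<le> q j")
      case True
      then have "norm (D s) \<le> 8 ^ j * \<sigma>" using IH s by auto
      moreover have "0 \<le> 8 ^ j * \<sigma>" using \<sigma>(1) by simp
      ultimately show ?thesis unfolding power_Suc mult.assoc by linarith
    next
      case False
      have "norm (D s) \<le> 0 / 2 + 2 * norm (D (q j)) + 6 * \<sigma>"
      proof (rule norm_step)
        show "integral {q j..q (Suc j)} k \<le> 1 / 16" using Suc.prems(2) by simp
      qed (use Suc.prems qm s False in auto)
      moreover have "norm (D (q j)) \<le> 8 ^ j * \<sigma>" using IH qm(1) by simp
      ultimately show ?thesis using * by linarith
    qed
  qed
qed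

end

subsection \<open>Approximate couplings of inputs\<close>

lemma continuous_on_eval_bcontfun:
  "continuous_on S (\<lambda>f. apply_bcontfun (f :: 'a::topological_space \<Rightarrow>\<^sub>C 'b::metric_space) t)"
  unfolding continuous_on_iff by (meson dist_bounded le_less_trans)

lemma measurable_CT_borelD:
  assumes "X \<in> measurable M (CT_borel T)"
  shows "X \<in> borel_measurable M" "\<And>\<omega>. \<omega> \<in> space M \<Longrightarrow> X \<omega> \<in> CT T"
    "(\<lambda>\<omega>. apply_bcontfun (X \<omega>) t) \<in> borel_measurable M"
proof -
  show X: "X \<in> borel_measurable M"
    using assms by (simp add: CT_borel_def measurable_restrict_space2_iff)
  show "X \<omega> \<in> CT T" if "\<omega> \<in> space M" for \<omega>
    using assms that by (auto simp: CT_borel_def measurable_restrict_space2_iff)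
  have "(\<lambda>f. apply_bcontfun f t) \<in> borel_measurable borel"
    by (intro borel_measurable_continuous_onI continuous_on_eval_bcontfun)
  from measurable_compose[OF X this] show "(\<lambda>\<omega>. apply_bcontfun (X \<omega>) t) \<in> borel_measurable M" .
qed

lemma CT_clamp: "f \<in> CT T \<Longrightarrow> apply_bcontfun f (max 0 (min T t)) = apply_bcontfun f t"
  by (simp add: CT_def)

lemma CT_dist_le:
  assumes "0 < T" "x \<in> CT T" "y \<in> CT T"
    and "\<And>t. t \<in> {0..T} \<Longrightarrow> dist (apply_bcontfun x t) (apply_bcontfun y t) \<le> b"
  shows "dist x y \<le> b"
proof (rule dist_bound)
  fix t
  have "max 0 (min T t) \<in> {0..T}" using assms(1) by auto
  from assms(4)[OF this] show "dist (apply_bcontfun x t) (apply_bcontfun y t) \<le> b"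
    by (simp add: CT_clamp assms(2,3))
qed

lemma closed_dist_eval_le:
  "closed {y :: real \<Rightarrow>\<^sub>C 'a::metric_space. dist (apply_bcontfun y s) c \<le> d}"
  "closed {y :: real \<Rightarrow>\<^sub>C 'a::metric_space. dist (apply_bcontfun y s) (apply_bcontfun y t) \<le> d}"
  by (intro closed_Collect_le continuous_intros continuous_on_eval_bcontfun)+

text \<open>
  A path is pinned down up to \<open>\<epsilon>\<close> by a modulus-of-continuity scale \<open>1/n\<close> and by its values on the
  grid of that scale, rounded to a countable dense set; \<open>I\<close> enumerates these data.
\<close>

lemma CT_countable_partition:
  assumes "0 < T" "0 < \<epsilon>"
  obtains I :: "(real \<Rightarrow>\<^sub>C 'a::euclidean_space) \<Rightarrow> nat"
  where "I \<in> measurable (CT_borel T) (count_space UNIV)"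
    "\<And>x y. x \<in> CT T \<Longrightarrow> y \<in> CT T \<Longrightarrow> I x = I y \<Longrightarrow> dist x y \<le> \<epsilon>"
proof -
  \<comment> \<open>Four errors of size \<open>d\<close> occur in the final comparison: for each of
    the two paths one from the modulus of continuity and one from rounding a grid value.\<close>
  define d where "d = \<epsilon> / 4"
  have d: "0 < d" using assms by (simp add: d_def)
  obtain Q :: "'a set" where Q: "countable Q" "\<And>X. open X \<Longrightarrow> X \<noteq> {} \<Longrightarrow> \<exists>q\<in>Q. q \<in> X"
    using countable_dense_setE by blast
  define Z where "Z = (\<lambda>(n::nat, f::nat \<Rightarrow> 'a). {y :: real \<Rightarrow>\<^sub>C 'a.
      (\<forall>i\<le>n. dist (apply_bcontfun y (T * real i / n)) (f i) \<le> d) \<and>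
      (\<forall>s t. \<bar>s - t\<bar> \<le> T / n \<longrightarrow> dist (apply_bcontfun y s) (apply_bcontfun y t) \<le> d)})"
  \<comment> \<open>For each \<open>n\<close> the rounded grid values form a countable set since
    only the \<open>n + 1\<close> arguments up to \<open>n\<close> are free.\<close>
  define J where "J = Sigma {0<..} (\<lambda>n::nat. PiE {..n} (\<lambda>_. Q))"
  have J: "countable J" unfolding J_def using Q(1) by (intro countable_SIGMA countable_PiE) auto
  \<comment> \<open>The modulus condition ranges over uncountably many pairs of times, so
    measurability is obtained from closedness.\<close>
  have "closed (Z j)" for j
  proof -
    have "Z j = (\<Inter>i\<in>{..fst j}. {y. dist (apply_bcontfun y (T * real i / fst j)) (snd j i) \<le> d}) \<inter>
      (\<Inter>(s, t)\<in>{(s, t). \<bar>s - t\<bar> \<le> T / fst j}. {y. dist (apply_bcontfun y s) (apply_bcontfun y t) \<le> d})"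
      by (auto simp: Z_def split: prod.split)
    then show ?thesis by (auto intro!: closed_Int closed_INT closed_dist_eval_le)
  qed
  then have Zm: "Z j \<in> sets borel" for j by simp
  have cover: "\<exists>j\<in>J. y \<in> Z j" if y: "y \<in> CT T" for y
  proof -
    have "uniformly_continuous_on {0..T} (apply_bcontfun y)"
      by (intro compact_uniformly_continuous) auto
    then obtain e where e: "e > 0" "\<And>s t. s \<in> {0..T} \<Longrightarrow> t \<in> {0..T} \<Longrightarrow> dist s t < e \<Longrightarrow>
        dist (apply_bcontfun y s) (apply_bcontfun y t) < d"
      using d by (metis uniformly_continuous_on_def)
    obtain n :: nat where n: "T / e < n" using reals_Archimedean2 by blast
    have n0: "0 < n"
      using n divide_pos_pos[OF assms(1) e(1)] by (cases n) auto
    have Tn: "T / n < e" using n e(1) n0 by (simp add: field_simps)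
    have "\<exists>q\<in>Q. dist (apply_bcontfun y t) q \<le> d" for t
      using Q(2)[of "ball (apply_bcontfun y t) d"] d less_imp_le by (metis ball_eq_empty linorder_not_less mem_ball open_ball)
    then obtain q where q: "\<And>t. q t \<in> Q" "\<And>t. dist (apply_bcontfun y t) (q t) \<le> d" by metis
    define f where "f = restrict (\<lambda>i. q (T * real i / n)) {..n}"
    have "dist (apply_bcontfun y s) (apply_bcontfun y t) \<le> d" if "\<bar>s - t\<bar> \<le> T / n" for s t
    proof -
      have "dist (max 0 (min T s)) (max 0 (min T t)) < e"
        using that Tn by (auto simp: dist_real_def min_def max_def)
      then have "dist (apply_bcontfun y (max 0 (min T s))) (apply_bcontfun y (max 0 (min T t))) < d"
        using assms(1) by (intro e(2)) auto
      then show ?thesis by (simp add: CT_clamp y)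
    qed
    then have "y \<in> Z (n, f)" using q(2) by (auto simp: Z_def f_def)
    moreover have "(n, f) \<in> J" using n0 q(1) by (auto simp: J_def f_def)
    ultimately show ?thesis by blast
  qed
  have small: "dist x y \<le> \<epsilon>" if "j \<in> J" "x \<in> Z j" "y \<in> Z j" "x \<in> CT T" "y \<in> CT T" for j x y
  proof (rule CT_dist_le[OF assms(1) that(4,5)])
    fix t assume t: "t \<in> {0..T}"
    obtain n f where nf: "j = (n, f)" by (cases j)
    then have j: "j = (n, f)" "0 < n" using that(1) by (auto simp: J_def)
    \<comment> \<open>The last grid point not after \<open>t\<close>. At \<open>t = T\<close> this
      is \<open>i = n\<close>, which is why the grid values include index \<open>n\<close>.\<close>
    define i where "i = nat \<lfloor>t * n / T\<rfloor>"
    have i1: "real i \<le> t * n / T" "t * n / T < real i + 1"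
      using t assms(1) by (auto simp: i_def)
    have "t * n / T \<le> n" using t assms(1) j by (simp add: field_simps mult_right_mono)
    then have i2: "i \<le> n" using i1 by linarith
    have i3: "\<bar>t - T * real i / n\<bar> \<le> T / n"
    proof -
      have "t - T * real i / n = T / n * (t * n / T - real i)" using assms(1) j by (simp add: field_simps)
      also have "\<bar>\<dots>\<bar> \<le> T / n * 1"
        unfolding abs_mult using i1 assms(1) by (intro mult_mono) auto
      finally show ?thesis by simp
    qed
    let ?s = "T * real i / n"
    have "dist (apply_bcontfun x t) (apply_bcontfun x ?s) \<le> d" "dist (apply_bcontfun y t) (apply_bcontfun y ?s) \<le> d"
      "dist (apply_bcontfun x ?s) (f i) \<le> d" "dist (apply_bcontfun y ?s) (f i) \<le> d"
      using that(2,3) i2 i3 by (auto simp: Z_def j)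
    moreover have "dist a b \<le> dist a a' + dist a' c + (dist b b' + dist b' c)" for a b a' b' c :: 'a
      by (meson dist_triangle dist_triangle2 add_mono order_trans)
    ultimately have "dist (apply_bcontfun x t) (apply_bcontfun y t) \<le> d + d + (d + d)"
      by (meson add_mono order_trans)
    then show "dist (apply_bcontfun x t) (apply_bcontfun y t) \<le> \<epsilon>" by (simp add: d_def)
  qed
  have J0: "J \<noteq> {}"
  proof -
    have "0 \<in> CT T" by (simp add: CT_def)
    then show ?thesis using cover by blast
  qed
  \<comment> \<open>The sets \<open>Z j\<close> overlap; choosing the first one that contains
    \<open>y\<close> turns the cover into a partition.\<close>
  define I where "I y = (LEAST k. y \<in> Z (from_nat_into J k))" for y
  have I: "y \<in> Z (from_nat_into J (I y))" if y: "y \<in> CT T" for y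
  proof -
    obtain j where "j \<in> J" "y \<in> Z j" using cover[OF y] by blast
    then have "\<exists>k. y \<in> Z (from_nat_into J k)" by (metis J from_nat_into_surj)
    then show ?thesis unfolding I_def by (rule LeastI_ex)
  qed
  show thesis
  proof (rule that[of I])
    have "I \<in> measurable borel (count_space UNIV)"
      unfolding I_def using Zm by (intro measurable_Least) simp
    then show "I \<in> measurable (CT_borel T) (count_space UNIV)"
      unfolding CT_borel_def by (rule measurable_restrict_space1)
    show "dist x y \<le> \<epsilon>" if "x \<in> CT T" "y \<in> CT T" "I x = I y" for x y
      using small[OF from_nat_into[OF J0] I[OF that(1)]] I[OF that(2)] that by simp
  qed
qed

text \<open>For \<open>x\<close> of index \<open>n\<close> the inner integral is the inverse mass of
  that index times the mass of index \<open>n\<close> under \<open>M2\<close>, and these masses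
  agree by \<open>eq\<close>; so the weight integrates to 1. Exchanging the two spaces gives the
  other marginal.\<close>

lemma index_coupling_fst_marginal:
  fixes I1 :: "'a \<Rightarrow> nat" and I2 :: "'b \<Rightarrow> nat"
  assumes M1: "prob_space M1" and M2: "prob_space M2"
    and I1 [measurable]: "I1 \<in> measurable M1 (count_space UNIV)"
    and I2 [measurable]: "I2 \<in> measurable M2 (count_space UNIV)"
    and eq: "distr M1 (count_space UNIV) I1 = distr M2 (count_space UNIV) I2"
    and A [measurable]: "A \<in> sets M1"
  shows "(\<integral>\<^sup>+x. \<integral>\<^sup>+y. (if I1 x = I2 y then inverse (emeasure M1 (I1 -` {I1 x} \<inter> space M1)) else 0) *
           indicator A x \<partial>M2 \<partial>M1) = emeasure M1 A"
proof -
  interpret M1: prob_space M1 by fact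
  interpret M2: prob_space M2 by fact
  define P where "P n = emeasure M1 (I1 -` {n} \<inter> space M1)" for n
  have P2: "emeasure M2 (I2 -` {n} \<inter> space M2) = P n" for n
    using arg_cong[OF eq, of "\<lambda>N. emeasure N {n}"] by (simp add: emeasure_distr P_def)
  \<comment> \<open>In \<open>ennreal\<close>, \<open>inverse 0 = \<infinity>\<close> and
    \<open>\<infinity> * 0 = 0\<close>, so the weight integrates to 0 on cells of mass 0. There are
    countably many of these, and together they are null.\<close>
  have ae: "AE x in M1. P (I1 x) \<noteq> 0"
  proof -
    have "AE x in M1. P n = 0 \<longrightarrow> I1 x \<noteq> n" for n
    proof (cases "P n = 0")
      case True
      then have "I1 -` {n} \<inter> space M1 \<in> null_sets M1" by (auto simp: P_def)
      then show ?thesis by (rule AE_I') auto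
    qed simp
    then have "AE x in M1. \<forall>n. P n = 0 \<longrightarrow> I1 x \<noteq> n" by (simp add: AE_all_countable)
    then show ?thesis by eventually_elim blast
  qed
  have "(\<integral>\<^sup>+y. (if I1 x = I2 y then inverse (P (I1 x)) else 0) * indicator A x \<partial>M2)
      = inverse (P (I1 x)) * P (I1 x) * indicator A x" for x
  proof -
    have "(\<integral>\<^sup>+y. (if I1 x = I2 y then inverse (P (I1 x)) else 0) * indicator A x \<partial>M2)
      = (\<integral>\<^sup>+y. inverse (P (I1 x)) * indicator A x * indicator (I2 -` {I1 x} \<inter> space M2) y \<partial>M2)"
      by (intro nn_integral_cong) (auto split: split_indicator)
    also have "\<dots> = inverse (P (I1 x)) * indicator A x * P (I1 x)"
      by (subst nn_integral_cmult_indicator) (auto simp: P2)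
    finally show ?thesis by (simp add: mult_ac)
  qed
  then have "(\<integral>\<^sup>+x. \<integral>\<^sup>+y. (if I1 x = I2 y then inverse (P (I1 x)) else 0) * indicator A x \<partial>M2 \<partial>M1)
     = (\<integral>\<^sup>+x. inverse (P (I1 x)) * P (I1 x) * indicator A x \<partial>M1)"
    by simp
  also have "\<dots> = (\<integral>\<^sup>+x. indicator A x \<partial>M1)"
  proof (rule nn_integral_cong_AE)
    show "AE x in M1. inverse (P (I1 x)) * P (I1 x) * indicator A x = indicator A x"
      using ae
    proof eventually_elim
      case (elim x)
      have "P (I1 x) \<noteq> \<infinity>" by (simp add: P_def)
      with elim show ?case
        using ennreal_divide_self[of "P (I1 x)"]
        by (simp add: divide_ennreal_def mult.commute top.not_eq_extremum)
    qed
  qed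
  also have "\<dots> = emeasure M1 A" by simp
  finally show ?thesis unfolding P_def .
qed

text \<open>
  Conditionally on a common value of the two indices the coordinates are independent; this replaces
  the gluing of couplings, which would need disintegrations.
\<close>

lemma index_coupling:
  fixes I1 :: "'a \<Rightarrow> nat" and I2 :: "'b \<Rightarrow> nat"
  assumes M1: "prob_space M1" and M2: "prob_space M2"
    and I1 [measurable]: "I1 \<in> measurable M1 (count_space UNIV)"
    and I2 [measurable]: "I2 \<in> measurable M2 (count_space UNIV)"
    and eq: "distr M1 (count_space UNIV) I1 = distr M2 (count_space UNIV) I2"
  obtains \<pi> where "sets \<pi> = sets (M1 \<Otimes>\<^sub>M M2)" "distr \<pi> M1 fst = M1" "distr \<pi> M2 snd = M2"
    "AE z in \<pi>. I1 (fst z) = I2 (snd z)"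
proof -
  interpret M1: prob_space M1 by fact
  interpret M2: prob_space M2 by fact
  interpret pair_prob_space M1 M2 ..
  define P where "P n = emeasure M1 (I1 -` {n} \<inter> space M1)" for n
  have P2: "P n = emeasure M2 (I2 -` {n} \<inter> space M2)" for n
    using arg_cong[OF eq, of "\<lambda>N. emeasure N {n}"] by (simp add: emeasure_distr P_def)
  \<comment> \<open>Density of the mixture, with weights \<open>P n\<close>, of the products of the
    conditional laws given index \<open>n\<close>: on matching indices it is
    \<open>P n / (P n * P n)\<close>.\<close>
  define f where "f = (\<lambda>z. if I1 (fst z) = I2 (snd z) then inverse (P (I1 (fst z))) else 0)"
  have f [measurable]: "f \<in> borel_measurable (M1 \<Otimes>\<^sub>M M2)"
  proof -
    have [measurable]: "(\<lambda>z. I1 (fst z)) \<in> measurable (M1 \<Otimes>\<^sub>M M2) (count_space UNIV)" by measurable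
    have [measurable]: "(\<lambda>z. inverse (P (I1 (fst z)))) \<in> borel_measurable (M1 \<Otimes>\<^sub>M M2)"
      by (rule measurable_compose[of _ _ "count_space UNIV" "\<lambda>n. inverse (P n)"]) simp_all
    \<comment> \<open>Agreement of the indices is a countable union over their common value, which
      makes it measurable.\<close>
    have "Measurable.pred (M1 \<Otimes>\<^sub>M M2) (\<lambda>z. \<exists>n. I2 (snd z) = n \<and> I1 (fst z) = n)" by measurable
    then have [measurable]: "Measurable.pred (M1 \<Otimes>\<^sub>M M2) (\<lambda>z. I1 (fst z) = I2 (snd z))" by simp
    show ?thesis unfolding f_def by measurable
  qed
  define \<pi> where "\<pi> = density (M1 \<Otimes>\<^sub>M M2) f"
  have sets [measurable_cong]: "sets \<pi> = sets (M1 \<Otimes>\<^sub>M M2)" by (simp add: \<pi>_def)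
  show thesis
  proof (rule that[of \<pi>])
    show "distr \<pi> M1 fst = M1"
    proof (rule measure_eqI)
      fix A assume "A \<in> sets (distr \<pi> M1 fst)"
      then have A [measurable]: "A \<in> sets M1" by simp
      have "emeasure (distr \<pi> M1 fst) A = emeasure \<pi> (fst -` A \<inter> space \<pi>)"
        by (simp add: emeasure_distr)
      also have "\<dots> = (\<integral>\<^sup>+z. f z * indicator (fst -` A \<inter> space \<pi>) z \<partial>(M1 \<Otimes>\<^sub>M M2))"
        unfolding \<pi>_def by (subst emeasure_density) (auto simp: measurable_fst)
      also have "\<dots> = (\<integral>\<^sup>+z. f z * indicator A (fst z) \<partial>(M1 \<Otimes>\<^sub>M M2))"
        by (intro nn_integral_cong) (auto simp: \<pi>_def split: split_indicator)
      also have "\<dots> = (\<integral>\<^sup>+x. \<integral>\<^sup>+y. f (x, y) * indicator A x \<partial>M2 \<partial>M1)"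
        by (subst M2.nn_integral_fst[symmetric]) auto
      also have "\<dots> = emeasure M1 A"
        unfolding f_def P_def fst_conv snd_conv by (rule index_coupling_fst_marginal[OF M1 M2 I1 I2 eq A])
      finally show "emeasure (distr \<pi> M1 fst) A = emeasure M1 A" .
    qed simp
    show "distr \<pi> M2 snd = M2"
    proof (rule measure_eqI)
      fix A assume "A \<in> sets (distr \<pi> M2 snd)"
      then have A [measurable]: "A \<in> sets M2" by simp
      have "emeasure (distr \<pi> M2 snd) A = emeasure \<pi> (snd -` A \<inter> space \<pi>)"
        by (simp add: emeasure_distr)
      also have "\<dots> = (\<integral>\<^sup>+z. f z * indicator (snd -` A \<inter> space \<pi>) z \<partial>(M1 \<Otimes>\<^sub>M M2))"
        unfolding \<pi>_def by (subst emeasure_density) (auto simp: measurable_snd)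
      also have "\<dots> = (\<integral>\<^sup>+z. f z * indicator A (snd z) \<partial>(M1 \<Otimes>\<^sub>M M2))"
        by (intro nn_integral_cong) (auto simp: \<pi>_def split: split_indicator)
      also have "\<dots> = (\<integral>\<^sup>+y. \<integral>\<^sup>+x. f (x, y) * indicator A y \<partial>M1 \<partial>M2)"
        by (subst nn_integral_snd[symmetric]) auto
      also have "\<dots> = (\<integral>\<^sup>+y. \<integral>\<^sup>+x. (if I2 y = I1 x then inverse (P (I2 y)) else 0) * indicator A y \<partial>M1 \<partial>M2)"
        by (intro nn_integral_cong) (auto simp: f_def)
      also have "\<dots> = emeasure M2 A"
        unfolding P2 by (rule index_coupling_fst_marginal[OF M2 M1 I2 I1 eq[symmetric] A])
      finally show "emeasure (distr \<pi> M2 snd) A = emeasure M2 A" .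
    qed simp
    show "AE z in \<pi>. I1 (fst z) = I2 (snd z)"
      unfolding \<pi>_def AE_density[OF f] by (simp add: f_def)
  qed (rule sets)
qed

text \<open>Equal input laws give equal laws of the cell index, and two paths in one cell are
  \<epsilon>-close, so matching the indices is enough.\<close>

lemma approximate_coupling:
  fixes Y1 :: "'a \<Rightarrow> real \<Rightarrow>\<^sub>C 'c::euclidean_space" and Y2 :: "'b \<Rightarrow> real \<Rightarrow>\<^sub>C 'c"
  assumes "0 < T" "0 < \<epsilon>" and M: "prob_space M1" "prob_space M2"
    and Y: "Y1 \<in> measurable M1 (CT_borel T)" "Y2 \<in> measurable M2 (CT_borel T)"
    and eq: "distr M1 (CT_borel T) Y1 = distr M2 (CT_borel T) Y2"
  obtains \<pi> where "sets \<pi> = sets (M1 \<Otimes>\<^sub>M M2)" "distr \<pi> M1 fst = M1" "distr \<pi> M2 snd = M2"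
    "AE z in \<pi>. dist (Y1 (fst z)) (Y2 (snd z)) \<le> \<epsilon>"
proof -
  obtain I :: "(real \<Rightarrow>\<^sub>C 'c) \<Rightarrow> nat" where I: "I \<in> measurable (CT_borel T) (count_space UNIV)"
    "\<And>x y. x \<in> CT T \<Longrightarrow> y \<in> CT T \<Longrightarrow> I x = I y \<Longrightarrow> dist x y \<le> \<epsilon>"
    using CT_countable_partition[OF assms(1,2)] by blast
  have "distr M1 (count_space UNIV) (I \<circ> Y1) = distr M2 (count_space UNIV) (I \<circ> Y2)"
    using distr_distr[OF I(1) Y(1)] distr_distr[OF I(1) Y(2)] eq by simp
  then obtain \<pi> where \<pi>: "sets \<pi> = sets (M1 \<Otimes>\<^sub>M M2)" "distr \<pi> M1 fst = M1" "distr \<pi> M2 snd = M2"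
    "AE z in \<pi>. (I \<circ> Y1) (fst z) = (I \<circ> Y2) (snd z)"
    using index_coupling[OF M measurable_comp[OF Y(1) I(1)] measurable_comp[OF Y(2) I(1)]] by metis
  have sp: "space \<pi> = space M1 \<times> space M2"
    using sets_eq_imp_space_eq[OF \<pi>(1)] by (simp add: space_pair_measure)
  from \<pi>(4) AE_space have "AE z in \<pi>. dist (Y1 (fst z)) (Y2 (snd z)) \<le> \<epsilon>"
  proof eventually_elim
    case (elim z)
    then show ?case
      using measurable_CT_borelD(2)[OF Y(1)] measurable_CT_borelD(2)[OF Y(2)] by (intro I(2)) (auto simp: sp)
  qed
  then show thesis using that \<pi> by blast
qed

subsection \<open>Comparison of laws through approximate couplings\<close>

text \<open>The coupling of the sample spaces is pushed forward under \<open>x1\<close> and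
  \<open>x2\<close> to a coupling of the laws. The cost is dominated by a constant plus functions of
  one coordinate each, so the bound sees only the marginals of \<open>\<pi>\<close> and is the same
  for every coupling with this domination.\<close>

lemma wasserstein_le_coupling:
  fixes x1 :: "'w1 \<Rightarrow> 'a::euclidean_space" and x2 :: "'w2 \<Rightarrow> 'a"
  assumes M1: "prob_space M1"
    and \<pi>: "sets \<pi> = sets (M1 \<Otimes>\<^sub>M M2)" "distr \<pi> M1 fst = M1" "distr \<pi> M2 snd = M2"
    and x [measurable]: "x1 \<in> borel_measurable M1" "x2 \<in> borel_measurable M2"
    and \<phi>1: "integrable M1 \<phi>1" "\<And>\<omega>. 0 \<le> \<phi>1 \<omega>" and \<phi>2: "integrable M2 \<phi>2" "\<And>\<omega>. 0 \<le> \<phi>2 \<omega>"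
    and c: "0 \<le> c" and p: "0 < p"
    and le: "AE z in \<pi>. norm (x1 (fst z) - x2 (snd z)) powr p \<le> c + \<phi>1 (fst z) + \<phi>2 (snd z)"
  shows "wasserstein p (distr M1 borel x1) (distr M2 borel x2)
           \<le> (c + integral\<^sup>L M1 \<phi>1 + integral\<^sup>L M2 \<phi>2) powr (1 / p)"
proof -
  interpret M1: prob_space M1 by fact
  note \<pi>(1)[measurable_cong]
  have \<phi>m [measurable]: "\<phi>1 \<in> borel_measurable M1" "\<phi>2 \<in> borel_measurable M2"
    using \<phi>1 \<phi>2 by auto
  interpret prob_space \<pi>
  proof (rule prob_spaceI)
    have "emeasure \<pi> (space \<pi>) = emeasure (distr \<pi> M1 fst) (space M1)"
      by (subst emeasure_distr) (auto intro!: arg_cong[of _ _ "emeasure \<pi>"] measurable_space[of fst \<pi> M1])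
    then show "emeasure \<pi> (space \<pi>) = 1" by (simp add: \<pi>(2) M1.emeasure_space_1)
  qed
  define \<rho> where "\<rho> = distr \<pi> (borel \<Otimes>\<^sub>M borel) (\<lambda>z. (x1 (fst z), x2 (snd z)))"
  have \<rho>: "\<rho> \<in> couplings (distr M1 borel x1) (distr M2 borel x2)"
  proof -
    have "distr \<rho> borel fst = distr (distr \<pi> M1 fst) borel x1"
      unfolding \<rho>_def by (subst (1 2) distr_distr) (auto simp: o_def)
    moreover have "distr \<rho> borel snd = distr (distr \<pi> M2 snd) borel x2"
      unfolding \<rho>_def by (subst (1 2) distr_distr) (auto simp: o_def)
    moreover have "prob_space \<rho>" unfolding \<rho>_def by (rule prob_space_distr) measurable
    ultimately show ?thesis unfolding couplings_def by (simp add: \<pi>(2,3)) (simp add: \<rho>_def)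
  qed
  have "(INF \<pi>\<in>couplings (distr M1 borel x1) (distr M2 borel x2). \<integral>\<^sup>+z. ennreal (norm (fst z - snd z) powr p) \<partial>\<pi>)
      \<le> (\<integral>\<^sup>+z. ennreal (norm (fst z - snd z) powr p) \<partial>\<rho>)"
    using \<rho> by (rule INF_lower)
  also have "\<dots> = (\<integral>\<^sup>+z. ennreal (norm (x1 (fst z) - x2 (snd z)) powr p) \<partial>\<pi>)"
    unfolding \<rho>_def by (subst nn_integral_distr) auto
  also have "\<dots> \<le> (\<integral>\<^sup>+z. ennreal c + ennreal (\<phi>1 (fst z)) + ennreal (\<phi>2 (snd z)) \<partial>\<pi>)"
    by (rule nn_integral_mono_AE, use le in eventually_elim)
      (simp add: c \<phi>1(2) \<phi>2(2) flip: ennreal_plus)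
  also have "\<dots> = ennreal c + (\<integral>\<^sup>+z. ennreal (\<phi>1 (fst z)) \<partial>\<pi>) + (\<integral>\<^sup>+z. ennreal (\<phi>2 (snd z)) \<partial>\<pi>)"
    by (simp add: nn_integral_add emeasure_space_1)
  also have "(\<integral>\<^sup>+z. ennreal (\<phi>1 (fst z)) \<partial>\<pi>) = (\<integral>\<^sup>+\<omega>. ennreal (\<phi>1 \<omega>) \<partial>distr \<pi> M1 fst)"
    by (subst nn_integral_distr) auto
  also have "\<dots> = ennreal (integral\<^sup>L M1 \<phi>1)"
    using \<phi>1 by (simp add: \<pi>(2) nn_integral_eq_integral)
  also have "(\<integral>\<^sup>+z. ennreal (\<phi>2 (snd z)) \<partial>\<pi>) = (\<integral>\<^sup>+\<omega>. ennreal (\<phi>2 \<omega>) \<partial>distr \<pi> M2 snd)"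
    by (subst nn_integral_distr) auto
  also have "\<dots> = ennreal (integral\<^sup>L M2 \<phi>2)"
    using \<phi>2 by (simp add: \<pi>(3) nn_integral_eq_integral)
  also have "ennreal c + ennreal (integral\<^sup>L M1 \<phi>1) + ennreal (integral\<^sup>L M2 \<phi>2)
      = ennreal (c + integral\<^sup>L M1 \<phi>1 + integral\<^sup>L M2 \<phi>2)"
    using c \<phi>1 \<phi>2 by (simp add: Bochner_Integration.integral_nonneg flip: ennreal_plus)
  finally have "enn2real (INF \<pi>\<in>couplings (distr M1 borel x1) (distr M2 borel x2).
      \<integral>\<^sup>+z. ennreal (norm (fst z - snd z) powr p) \<partial>\<pi>) \<le> c + integral\<^sup>L M1 \<phi>1 + integral\<^sup>L M2 \<phi>2"
    by (rule enn2real_leI[rotated]) (use c \<phi>1 \<phi>2 in \<open>auto intro!: add_nonneg_nonneg Bochner_Integration.integral_nonneg\<close>)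
  then show ?thesis
    unfolding wasserstein_def using p by (intro powr_mono2) auto
qed

section \<open>Moment tails and exceptional events\<close>

lemma norm_diff_powr_le:
  fixes a b :: "'a::real_normed_vector"
  assumes "0 < p"
  shows "norm (a - b) powr p \<le> 2 powr p * (norm a powr p + norm b powr p)"
proof -
  have "norm (a - b) powr p \<le> (2 * max (norm a) (norm b)) powr p"
    using assms norm_triangle_ineq4[of a b] by (intro powr_mono2) auto
  also have "\<dots> = 2 powr p * max (norm a) (norm b) powr p"
    by (rule powr_mult)
  also have "\<dots> \<le> 2 powr p * (norm a powr p + norm b powr p)"
    by (intro mult_left_mono) (auto simp: max_def)
  finally show ?thesis .
qed

lemma (in prob_space) integral_truncation_tendsto_0:
  fixes u :: "'a \<Rightarrow> real"
  assumes u: "integrable M u"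
  shows "(\<lambda>n. \<integral>\<omega>. (if real n < u \<omega> then u \<omega> else 0) \<partial>M) \<longlonglongrightarrow> 0"
proof -
  have [measurable]: "u \<in> borel_measurable M" using u by auto
  have "(\<lambda>n. \<integral>\<omega>. (if real n < u \<omega> then u \<omega> else 0) \<partial>M) \<longlonglongrightarrow> (\<integral>\<omega>. 0 \<partial>M)"
  proof (rule integral_dominated_convergence)
    show "integrable M (\<lambda>\<omega>. \<bar>u \<omega>\<bar>)" using u by auto
    show "AE \<omega> in M. (\<lambda>n. if real n < u \<omega> then u \<omega> else 0) \<longlonglongrightarrow> 0"
    proof (rule AE_I2)
      fix \<omega>
      obtain k :: nat where "u \<omega> < k" using reals_Archimedean2 by blast
      then have "\<forall>\<^sub>F n in sequentially. (if real n < u \<omega> then u \<omega> else 0) = 0"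
        by (intro eventually_sequentiallyI[of k]) auto
      then show "(\<lambda>n. if real n < u \<omega> then u \<omega> else 0) \<longlonglongrightarrow> 0"
        by (rule tendsto_eventually)
    qed
    show "AE \<omega> in M. norm (if real n < u \<omega> then u \<omega> else 0) \<le> \<bar>u \<omega>\<bar>" for n
      by auto
  qed simp_all
  then show ?thesis by simp
qed

lemma (in prob_space) prob_compl_incseq_tendsto_0:
  assumes G: "\<And>n. G n \<in> events" "incseq G" and ae: "AE \<omega> in M. \<exists>n. \<omega> \<in> G n"
  shows "(\<lambda>n. prob (space M - G n)) \<longlonglongrightarrow> 0"
proof -
  have "(\<lambda>n. prob (G n)) \<longlonglongrightarrow> prob (\<Union>n. G n)"
    using G by (intro finite_Lim_measure_incseq) auto
  moreover have "prob (\<Union>n. G n) = 1"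
    using G ae by (subst prob_eq_1) auto
  ultimately have "(\<lambda>n. 1 - prob (G n)) \<longlonglongrightarrow> 1 - 1" by (intro tendsto_diff) auto
  then show ?thesis using G by (simp add: prob_compl)
qed


text \<open>\<open>G1 n\<close> and \<open>G2 n\<close> are increasing events on which an estimate
  with constants depending on \<open>n\<close> is available; \<open>Q1\<close> and \<open>Q2\<close>
  are almost sure properties such as solving the path equation. Each concerns one coordinate only,
  so it has the same probability under every coupling of \<open>M1\<close> and
  \<open>M2\<close>.\<close>

locale equal_inputs =
  fixes T :: real and M1 :: "'w1 measure" and M2 :: "'w2 measure"
    and Y1 :: "'w1 \<Rightarrow> real \<Rightarrow>\<^sub>C 'a::euclidean_space" and Y2 :: "'w2 \<Rightarrow> real \<Rightarrow>\<^sub>C 'a"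
    and G1 :: "nat \<Rightarrow> 'w1 set" and G2 :: "nat \<Rightarrow> 'w2 set"
    and Q1 :: "'w1 \<Rightarrow> bool" and Q2 :: "'w2 \<Rightarrow> bool"
  assumes T: "0 < T" and M1: "prob_space M1" and M2: "prob_space M2"
    and Y1: "Y1 \<in> measurable M1 (CT_borel T)" and Y2: "Y2 \<in> measurable M2 (CT_borel T)"
    and Y_eq: "distr M1 (CT_borel T) Y1 = distr M2 (CT_borel T) Y2"
    and G1 [measurable]: "\<And>n. G1 n \<in> sets M1" and G1_mono: "incseq G1"
    and G1_ae: "AE \<omega> in M1. \<exists>n. \<omega> \<in> G1 n"
    and G2 [measurable]: "\<And>n. G2 n \<in> sets M2" and G2_mono: "incseq G2"
    and G2_ae: "AE \<omega> in M2. \<exists>n. \<omega> \<in> G2 n"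
    and Q1: "AE \<omega> in M1. Q1 \<omega>" and Q2: "AE \<omega> in M2. Q2 \<omega>"
begin

lemma obtain_coupling:
  assumes "0 < \<epsilon>"
  obtains \<pi> where "sets \<pi> = sets (M1 \<Otimes>\<^sub>M M2)" "distr \<pi> M1 fst = M1" "distr \<pi> M2 snd = M2"
    "AE z in \<pi>. fst z \<in> space M1 \<and> snd z \<in> space M2 \<and> Q1 (fst z) \<and> Q2 (snd z) \<and> dist (Y1 (fst z)) (Y2 (snd z)) \<le> \<epsilon>"
proof -
  obtain \<pi> where \<pi>: "sets \<pi> = sets (M1 \<Otimes>\<^sub>M M2)" "distr \<pi> M1 fst = M1" "distr \<pi> M2 snd = M2"
    "AE z in \<pi>. dist (Y1 (fst z)) (Y2 (snd z)) \<le> \<epsilon>"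
    using approximate_coupling[OF T assms M1 M2 Y1 Y2 Y_eq] by blast
  note \<pi>(1)[measurable_cong]
  have "AE z in \<pi>. fst z \<in> space M1 \<and> Q1 (fst z)"
  proof (rule AE_distrD[of fst \<pi> M1])
    show "AE \<omega> in distr \<pi> M1 fst. \<omega> \<in> space M1 \<and> Q1 \<omega>"
      unfolding \<pi>(2) using Q1 AE_space by eventually_elim simp
  qed simp
  moreover have "AE z in \<pi>. snd z \<in> space M2 \<and> Q2 (snd z)"
  proof (rule AE_distrD[of snd \<pi> M2])
    show "AE \<omega> in distr \<pi> M2 snd. \<omega> \<in> space M2 \<and> Q2 \<omega>"
      unfolding \<pi>(3) using Q2 AE_space by eventually_elim simp
  qed simp
  ultimately have "AE z in \<pi>. fst z \<in> space M1 \<and> snd z \<in> space M2 \<and> Q1 (fst z) \<and> Q2 (snd z) \<and> dist (Y1 (fst z)) (Y2 (snd z)) \<le> \<epsilon>"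
    using \<pi>(4) by eventually_elim auto
  then show thesis using that \<pi> by blast
qed

text \<open>The order of choices matters: a truncation level \<open>L\<close> for the
  \<open>p\<close>-th moments, then \<open>n\<close> so large that the bad events are small compared
  with \<open>1 / L\<close>, then \<epsilon> from \<open>near\<close>, and the coupling last. On the
  good event the cost is at most \<open>(c + \<tau>) powr p\<close>; off it the moments bound it,
  split at level \<open>L\<close>.\<close>

lemma wasserstein_le:
  fixes x1 :: "'w1 \<Rightarrow> 'b::euclidean_space" and x2 :: "'w2 \<Rightarrow> 'b"
  assumes x [measurable]: "x1 \<in> borel_measurable M1" "x2 \<in> borel_measurable M2"
    and u: "integrable M1 (\<lambda>\<omega>. norm (x1 \<omega>) powr p)" "integrable M2 (\<lambda>\<omega>. norm (x2 \<omega>) powr p)"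
    and p: "0 < p" and c: "0 \<le> c"
    and near: "\<And>n \<tau>. 0 < \<tau> \<Longrightarrow> \<exists>\<epsilon>>0. \<forall>\<omega>1\<in>G1 n. \<forall>\<omega>2\<in>G2 n. Q1 \<omega>1 \<longrightarrow> Q2 \<omega>2 \<longrightarrow>
        dist (Y1 \<omega>1) (Y2 \<omega>2) \<le> \<epsilon> \<longrightarrow> norm (x1 \<omega>1 - x2 \<omega>2) \<le> c + \<tau>"
  shows "wasserstein p (distr M1 borel x1) (distr M2 borel x2) \<le> c"
proof -
  interpret M1: prob_space M1 by (rule M1)
  interpret M2: prob_space M2 by (rule M2)
  define u1 where "u1 \<omega> = norm (x1 \<omega>) powr p" for \<omega>
  define u2 where "u2 \<omega> = norm (x2 \<omega>) powr p" for \<omega>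
  have ui: "integrable M1 u1" "integrable M2 u2" using u unfolding u1_def u2_def by auto
  have u0: "0 \<le> u1 \<omega>" "0 \<le> u2 \<omega>'" for \<omega> \<omega>' by (auto simp: u1_def u2_def)
  define K where "K = 2 powr p"
  have K: "0 < K" by (simp add: K_def)
  define W where "W = wasserstein p (distr M1 borel x1) (distr M2 borel x2)"
  have main: "W \<le> ((c + \<tau>) powr p + 2 * \<tau>) powr (1 / p)" if \<tau>: "0 < \<tau>" for \<tau>
  proof -
    have "0 < \<tau> / (2 * K)" using \<tau> K by simp
    then have "\<forall>\<^sub>F n in sequentially. (\<integral>\<omega>. (if real n < u1 \<omega> then u1 \<omega> else 0) \<partial>M1) < \<tau> / (2 * K) \<and>
        (\<integral>\<omega>. (if real n < u2 \<omega> then u2 \<omega> else 0) \<partial>M2) < \<tau> / (2 * K)"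
      using M1.integral_truncation_tendsto_0[OF ui(1)] M2.integral_truncation_tendsto_0[OF ui(2)]
      by (intro eventually_conj order_tendstoD(2)) auto
    then obtain L :: nat where L: "(\<integral>\<omega>. (if real L < u1 \<omega> then u1 \<omega> else 0) \<partial>M1) < \<tau> / (2 * K)"
        "(\<integral>\<omega>. (if real L < u2 \<omega> then u2 \<omega> else 0) \<partial>M2) < \<tau> / (2 * K)"
      by (auto simp: eventually_sequentially)
    have "0 < \<tau> / (4 * K * (real L + 1))" using \<tau> K by simp
    then have "\<forall>\<^sub>F n in sequentially. measure M1 (space M1 - G1 n) < \<tau> / (4 * K * (real L + 1)) \<and>
        measure M2 (space M2 - G2 n) < \<tau> / (4 * K * (real L + 1))"
      using M1.prob_compl_incseq_tendsto_0[OF G1 G1_mono G1_ae] M2.prob_compl_incseq_tendsto_0[OF G2 G2_mono G2_ae]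
      by (intro eventually_conj order_tendstoD(2)) auto
    then obtain n where n: "measure M1 (space M1 - G1 n) < \<tau> / (4 * K * (real L + 1))"
        "measure M2 (space M2 - G2 n) < \<tau> / (4 * K * (real L + 1))"
      by (auto simp: eventually_sequentially)
    \<comment> \<open>Below level \<open>L\<close> the two moments together contribute at most
      \<open>2 * L\<close>. One bad event alone may have to pay for both, hence \<open>2 * L\<close>
      in \<open>\<phi>1\<close> and in \<open>\<phi>2\<close>.\<close>
    define \<phi>1 where "\<phi>1 \<omega> = K * (2 * L * indicat_real (space M1 - G1 n) \<omega> + (if real L < u1 \<omega> then u1 \<omega> else 0))" for \<omega>
    define \<phi>2 where "\<phi>2 \<omega> = K * (2 * L * indicat_real (space M2 - G2 n) \<omega> + (if real L < u2 \<omega> then u2 \<omega> else 0))" for \<omega>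
    have um [measurable]: "u1 \<in> borel_measurable M1" "u2 \<in> borel_measurable M2" using ui by auto
    have ti: "integrable M1 (\<lambda>\<omega>. if real L < u1 \<omega> then u1 \<omega> else 0)"
      "integrable M2 (\<lambda>\<omega>. if real L < u2 \<omega> then u2 \<omega> else 0)"
      by (rule Bochner_Integration.integrable_bound[OF ui(1)]; simp add: u0)
         (rule Bochner_Integration.integrable_bound[OF ui(2)]; simp add: u0)
    have ii: "integrable M1 (indicat_real (space M1 - G1 n))" "integrable M2 (indicat_real (space M2 - G2 n))"
      by (auto intro!: integrable_real_indicator simp: M1.emeasure_eq_measure M2.emeasure_eq_measure)
    have \<phi>i: "integrable M1 \<phi>1" "integrable M2 \<phi>2"
      unfolding \<phi>1_def \<phi>2_def by (intro Bochner_Integration.integrable_add integrable_mult_right ti ii)+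
    have \<phi>0: "0 \<le> \<phi>1 \<omega>" "0 \<le> \<phi>2 \<omega>'" for \<omega> \<omega>'
      using K u0 by (auto simp: \<phi>1_def \<phi>2_def)
    \<comment> \<open>The thresholds give \<open>\<tau> / 2\<close> for the indicator part and
      \<open>\<tau> / 2\<close> for the tail; \<open>L + 1\<close> guards against
      \<open>L = 0\<close>.\<close>
    have small: "K * (2 * L * a + b) \<le> \<tau>" if "a < \<tau> / (4 * K * (real L + 1))" "b < \<tau> / (2 * K)" for a b :: real
    proof -
      have "K * (2 * L * a) \<le> K * (2 * L * (\<tau> / (4 * K * (real L + 1))))"
        using that K by (intro mult_left_mono) auto
      also have "\<dots> = \<tau> / 2 * (L / (real L + 1))" using K by simp
      also have "\<dots> \<le> \<tau> / 2 * 1" using \<tau> by (intro mult_left_mono) auto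
      finally have "K * (2 * L * a) \<le> \<tau> / 2" by simp
      moreover have "K * b \<le> \<tau> / 2" using that K by (simp add: field_simps)
      ultimately show ?thesis by (simp add: distrib_left)
    qed
    have \<phi>int: "integral\<^sup>L M1 \<phi>1 \<le> \<tau>" "integral\<^sup>L M2 \<phi>2 \<le> \<tau>"
      unfolding \<phi>1_def \<phi>2_def
      using small[OF n(1) L(1)] small[OF n(2) L(2)]
      by (simp_all add: Bochner_Integration.integral_add ti ii)
    obtain \<epsilon> where \<epsilon>: "0 < \<epsilon>" "\<And>\<omega>1 \<omega>2. \<omega>1 \<in> G1 n \<Longrightarrow> \<omega>2 \<in> G2 n \<Longrightarrow> Q1 \<omega>1 \<Longrightarrow> Q2 \<omega>2 \<Longrightarrow>
        dist (Y1 \<omega>1) (Y2 \<omega>2) \<le> \<epsilon> \<Longrightarrow> norm (x1 \<omega>1 - x2 \<omega>2) \<le> c + \<tau>"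
      using near[OF \<tau>, of n] by blast
    obtain \<pi> where \<pi>: "sets \<pi> = sets (M1 \<Otimes>\<^sub>M M2)" "distr \<pi> M1 fst = M1" "distr \<pi> M2 snd = M2"
      "AE z in \<pi>. fst z \<in> space M1 \<and> snd z \<in> space M2 \<and> Q1 (fst z) \<and> Q2 (snd z) \<and> dist (Y1 (fst z)) (Y2 (snd z)) \<le> \<epsilon>"
      using obtain_coupling[OF \<epsilon>(1)] by blast
    have "W \<le> ((c + \<tau>) powr p + integral\<^sup>L M1 \<phi>1 + integral\<^sup>L M2 \<phi>2) powr (1 / p)"
      unfolding W_def
    proof (rule wasserstein_le_coupling[OF M1 \<pi>(1-3) x \<phi>i(1) \<phi>0(1) \<phi>i(2) \<phi>0(2) _ p])
      show "AE z in \<pi>. norm (x1 (fst z) - x2 (snd z)) powr p \<le> (c + \<tau>) powr p + \<phi>1 (fst z) + \<phi>2 (snd z)"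
        using \<pi>(4)
      proof eventually_elim
        case (elim z)
        show ?case
        proof (cases "fst z \<in> G1 n \<and> snd z \<in> G2 n")
          case True
          then have "norm (x1 (fst z) - x2 (snd z)) powr p \<le> (c + \<tau>) powr p"
            using elim p by (intro powr_mono2 \<epsilon>(2)) auto
          then show ?thesis using \<phi>0(1)[of "fst z"] \<phi>0(2)[of "snd z"] by linarith
        next
          case False
          have "norm (x1 (fst z) - x2 (snd z)) powr p \<le> K * (u1 (fst z) + u2 (snd z))"
            unfolding K_def u1_def u2_def by (rule norm_diff_powr_le[OF p])
          also have "\<dots> \<le> K * ((2 * L * indicat_real (space M1 - G1 n) (fst z) + (if real L < u1 (fst z) then u1 (fst z) else 0))
              + (2 * L * indicat_real (space M2 - G2 n) (snd z) + (if real L < u2 (snd z) then u2 (snd z) else 0)))"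
            using False elim K by (intro mult_left_mono) (auto split: split_indicator)
          also have "\<dots> = \<phi>1 (fst z) + \<phi>2 (snd z)" by (simp add: \<phi>1_def \<phi>2_def distrib_left)
          finally show ?thesis by (smt (verit) powr_ge_zero)
        qed
      qed
    qed simp
    also have "\<dots> \<le> ((c + \<tau>) powr p + 2 * \<tau>) powr (1 / p)"
      using \<phi>int \<phi>i \<phi>0 p by (intro powr_mono2) (auto intro!: add_nonneg_nonneg Bochner_Integration.integral_nonneg)
    finally show ?thesis .
  qed
  \<comment> \<open>For \<open>c = 0\<close> the limit is taken at base 0, where continuity of
    \<open>powr\<close> rests on nonnegative bases and a positive exponent.\<close>
  have "((\<lambda>\<tau>. ((c + \<tau>) powr p + 2 * \<tau>) powr (1 / p)) \<longlongrightarrow> ((c + 0) powr p + 2 * 0) powr (1 / p)) (at_right 0)"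
    using p c
    by (intro tendsto_powr' tendsto_add tendsto_mult tendsto_const tendsto_ident_at)
      (auto simp: eventually_at_filter intro!: always_eventually)
  moreover have "((c + 0) powr p + 2 * 0) powr (1 / p) = c"
    using c p by (simp add: powr_powr)
  ultimately have "((\<lambda>\<tau>. ((c + \<tau>) powr p + 2 * \<tau>) powr (1 / p)) \<longlongrightarrow> c) (at_right 0)" by simp
  then have "W \<le> c"
    by (rule tendsto_lowerbound) (use main in \<open>auto simp: eventually_at_filter\<close>)
  then show ?thesis by (simp add: W_def)
qed

text \<open>On the good events \<open>X1 \<in> F\<close> forces \<open>X2\<close> into the closed
  \<tau>-neighbourhood of \<open>F\<close>. The coupling changes with \<open>n\<close> and \<tau>,
  but the resulting inequality mentions the marginals only, so first \<open>n\<close> can tend to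
  infinity and then \<tau> to 0, where closedness recovers \<open>F\<close>.\<close>

lemma closed_prob_le:
  assumes X: "X1 \<in> borel_measurable M1" "X2 \<in> borel_measurable M2"
    and near: "\<And>n \<tau>. 0 < \<tau> \<Longrightarrow> \<exists>\<epsilon>>0. \<forall>\<omega>1\<in>G1 n. \<forall>\<omega>2\<in>G2 n. Q1 \<omega>1 \<longrightarrow> Q2 \<omega>2 \<longrightarrow>
        dist (Y1 \<omega>1) (Y2 \<omega>2) \<le> \<epsilon> \<longrightarrow> dist (X1 \<omega>1) (X2 \<omega>2) \<le> \<tau>"
    and F: "closed (F :: 'c::metric_space set)"
  shows "measure M1 (X1 -` F \<inter> space M1) \<le> measure M2 (X2 -` F \<inter> space M2)"
proof (cases "F = {}")
  \<comment> \<open>\<open>infdist\<close> to the empty set is 0 by convention, so its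
    neighbourhoods would be the whole space.\<close>
  case False
  interpret M1: prob_space M1 by (rule M1)
  interpret M2: prob_space M2 by (rule M2)
  define E where "E \<tau> = X2 -` {x. infdist x F \<le> \<tau>} \<inter> space M2" for \<tau>
  have E [measurable]: "E \<tau> \<in> sets M2" for \<tau>
    unfolding E_def using X(2)
    by (rule measurable_sets) (intro borel_closed closed_Collect_le continuous_intros)
  have XF [measurable]: "X1 -` F \<inter> space M1 \<in> sets M1"
    using X(1) F by (auto intro: measurable_sets)
  have step: "measure M1 (X1 -` F \<inter> space M1) \<le> measure M2 (E \<tau>) + measure M1 (space M1 - G1 n) + measure M2 (space M2 - G2 n)"
    if \<tau>: "0 < \<tau>" for n \<tau>
  proof -
    obtain \<epsilon> where \<epsilon>: "0 < \<epsilon>" "\<And>\<omega>1 \<omega>2. \<omega>1 \<in> G1 n \<Longrightarrow> \<omega>2 \<in> G2 n \<Longrightarrow> Q1 \<omega>1 \<Longrightarrow> Q2 \<omega>2 \<Longrightarrow>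
        dist (Y1 \<omega>1) (Y2 \<omega>2) \<le> \<epsilon> \<Longrightarrow> dist (X1 \<omega>1) (X2 \<omega>2) \<le> \<tau>"
      using near[OF \<tau>, of n] by blast
    obtain \<pi> where \<pi>: "sets \<pi> = sets (M1 \<Otimes>\<^sub>M M2)" "distr \<pi> M1 fst = M1" "distr \<pi> M2 snd = M2"
      "AE z in \<pi>. fst z \<in> space M1 \<and> snd z \<in> space M2 \<and> Q1 (fst z) \<and> Q2 (snd z) \<and> dist (Y1 (fst z)) (Y2 (snd z)) \<le> \<epsilon>"
      using obtain_coupling[OF \<epsilon>(1)] by blast
    note \<pi>(1)[measurable_cong]
    have m1: "emeasure M1 A = emeasure \<pi> (fst -` A \<inter> space \<pi>)" "fst -` A \<inter> space \<pi> \<in> sets \<pi>" if "A \<in> sets M1" for A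
      using that emeasure_distr[of fst \<pi> M1 A] measurable_sets[of fst \<pi> M1 A] by (simp_all add: \<pi>(2))
    have m2: "emeasure M2 A = emeasure \<pi> (snd -` A \<inter> space \<pi>)" "snd -` A \<inter> space \<pi> \<in> sets \<pi>" if "A \<in> sets M2" for A
      using that emeasure_distr[of snd \<pi> M2 A] measurable_sets[of snd \<pi> M2 A] by (simp_all add: \<pi>(3))
    have "emeasure M1 (X1 -` F \<inter> space M1) = emeasure \<pi> (fst -` (X1 -` F \<inter> space M1) \<inter> space \<pi>)"
      by (rule m1) measurable
    also have "\<dots> \<le> emeasure \<pi> ((snd -` E \<tau> \<inter> space \<pi>) \<union> (fst -` (space M1 - G1 n) \<inter> space \<pi>)
        \<union> (snd -` (space M2 - G2 n) \<inter> space \<pi>))"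
    proof (rule emeasure_mono_AE)
      show "AE z in \<pi>. z \<in> fst -` (X1 -` F \<inter> space M1) \<inter> space \<pi> \<longrightarrow>
          z \<in> (snd -` E \<tau> \<inter> space \<pi>) \<union> (fst -` (space M1 - G1 n) \<inter> space \<pi>) \<union> (snd -` (space M2 - G2 n) \<inter> space \<pi>)"
        using \<pi>(4)
      proof eventually_elim
        case (elim z)
        have "infdist (X2 (snd z)) F \<le> \<tau>" if "X1 (fst z) \<in> F" "fst z \<in> G1 n" "snd z \<in> G2 n"
          using infdist_le2[OF that(1), of "X2 (snd z)" \<tau>] \<epsilon>(2)[OF that(2,3)] elim by (simp add: dist_commute)
        then show ?case using elim by (auto simp: E_def)
      qed
    qed (intro sets.Un m1 m2; measurable)
    also have "\<dots> \<le> emeasure \<pi> (snd -` E \<tau> \<inter> space \<pi>) + emeasure \<pi> (fst -` (space M1 - G1 n) \<inter> space \<pi>)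
        + emeasure \<pi> (snd -` (space M2 - G2 n) \<inter> space \<pi>)"
      by (intro order_trans[OF emeasure_subadditive] add_right_mono sets.Un m1 m2 order_refl; measurable)
    also have "\<dots> = emeasure M2 (E \<tau>) + emeasure M1 (space M1 - G1 n) + emeasure M2 (space M2 - G2 n)"
      by (simp add: m1(1) m2(1))
    finally show ?thesis
      by (simp add: M1.emeasure_eq_measure M2.emeasure_eq_measure flip: ennreal_plus)
  qed
  have le: "measure M1 (X1 -` F \<inter> space M1) \<le> measure M2 (E \<tau>)" if "0 < \<tau>" for \<tau>
  proof (rule tendsto_lowerbound)
    show "(\<lambda>n. measure M2 (E \<tau>) + measure M1 (space M1 - G1 n) + measure M2 (space M2 - G2 n)) \<longlonglongrightarrow> measure M2 (E \<tau>)"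
      using tendsto_add[OF tendsto_add[OF tendsto_const M1.prob_compl_incseq_tendsto_0[OF G1 G1_mono G1_ae]]
          M2.prob_compl_incseq_tendsto_0[OF G2 G2_mono G2_ae]] by simp
  qed (use step[OF that] in auto)
  show ?thesis
  proof (rule tendsto_lowerbound)
    have "(\<Inter>n. E (inverse (real (Suc n)))) = X2 -` F \<inter> space M2"
    proof -
      have "infdist x F \<le> 0" if "\<And>n. infdist x F \<le> inverse (real (Suc n))" for x
        using LIMSEQ_le_const[OF LIMSEQ_inverse_real_of_nat, of "infdist x F"] that by auto
      then have "x \<in> F \<longleftrightarrow> (\<forall>n. infdist x F \<le> inverse (real (Suc n)))" for x
        using in_closed_iff_infdist_zero[OF F False, of x] infdist_nonneg[of x F]
        by (metis antisym inverse_nonnegative_iff_nonnegative of_nat_0_le_iff)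
      then show ?thesis by (auto simp: E_def)
    qed
    moreover have "(\<lambda>n. measure M2 (E (inverse (real (Suc n))))) \<longlonglongrightarrow> measure M2 (\<Inter>n. E (inverse (real (Suc n))))"
    proof (rule M2.finite_Lim_measure_decseq)
      show "decseq (\<lambda>n. E (inverse (real (Suc n))))"
        by (auto simp: decseq_def E_def intro: order_trans[OF _ le_imp_inverse_le])
    qed (use E in auto)
    ultimately show "(\<lambda>n. measure M2 (E (inverse (real (Suc n))))) \<longlonglongrightarrow> measure M2 (X2 -` F \<inter> space M2)"
      by simp
  qed (auto intro!: always_eventually le)
qed simp

end

text \<open>The closed sets form an intersection-stable generator of the Borel sets, and they are
  the sets that \<open>closed_prob_le\<close> controls.\<close>

lemma distr_borel_eqI_closed:
  fixes X1 :: "'w1 \<Rightarrow> 'c::metric_space"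
  assumes "prob_space M1" "prob_space M2"
    and X: "X1 \<in> borel_measurable M1" "X2 \<in> borel_measurable M2"
    and eq: "\<And>F. closed F \<Longrightarrow> measure M1 (X1 -` F \<inter> space M1) = measure M2 (X2 -` F \<inter> space M2)"
  shows "distr M1 borel X1 = distr M2 borel X2"
proof (rule measure_eqI_generator_eq[where \<Omega>=UNIV and E="Collect closed" and A="\<lambda>_. UNIV"])
  interpret M1: prob_space M1 by fact
  interpret M2: prob_space M2 by fact
  show "emeasure (distr M1 borel X1) F = emeasure (distr M2 borel X2) F" if "F \<in> Collect closed" for F
    using that X eq by (simp add: emeasure_distr M1.emeasure_eq_measure M2.emeasure_eq_measure)
  show "emeasure (distr M1 borel X1) UNIV \<noteq> \<infinity>"
    using X by (simp add: emeasure_distr M1.emeasure_eq_measure)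
qed (auto simp: Int_stable_def borel_eq_closed)

subsection \<open>Localisation of solutions by variation\<close>

lemma variation_sum_integral_le:
  fixes g :: "real \<Rightarrow> 'a::euclidean_space"
  assumes g: "g absolutely_integrable_on {0..T}" and t: "t \<in> {0..T}"
  shows "variation_sum n t (\<lambda>s. integral {0..s} g) \<le> integral {0..T} (\<lambda>s. norm (g s))"
proof (cases "n = 0")
  case True
  then show ?thesis using g
    by (simp add: variation_sum_def absolutely_integrable_on_def integral_nonneg)
next
  case False
  then have n: "0 < n" and t0: "0 \<le> t" using t by auto
  have gi: "g integrable_on {0..T}" "(\<lambda>s. norm (g s)) integrable_on {0..T}"
    using g by (auto simp: absolutely_integrable_on_def)
  define p where "p i = t * real i / n" for i
  note up = uniform_partition[OF t0 n, folded p_def]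
  define K where "K s = integral {0..s} (\<lambda>s. norm (g s))" for s
  have "norm (integral {0..p (Suc i)} g - integral {0..p i} g) \<le> K (p (Suc i)) - K (p i)" if i: "i < n" for i
  proof -
    have pm: "0 \<le> p i" "p i \<le> p (Suc i)" "p (Suc i) \<le> T"
      using up(4)[OF i, of "p (Suc i)"] up(4)[OF i, of "p i"] up(1)[of i] t by auto
    have sub: "f integrable_on {0..p (Suc i)}" "f integrable_on {p i..p (Suc i)}"
      if "f integrable_on {0..T}" for f :: "real \<Rightarrow> 'b::euclidean_space"
      using that pm by (auto intro: integrable_subinterval_real)
    have c: "integral {0..p (Suc i)} f - integral {0..p i} f = integral {p i..p (Suc i)} f"
      if "f integrable_on {0..T}" for f :: "real \<Rightarrow> 'b::euclidean_space"
      using Henstock_Kurzweil_Integration.integral_combine[OF pm(1,2) sub(1)[OF that]] by (simp add: algebra_simps)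
    show ?thesis
      unfolding c[OF gi(1)] K_def c[OF gi(2)] using sub[OF gi(1)] sub[OF gi(2)]
      by (intro integral_norm_bound_integral) auto
  qed
  then have "variation_sum n t (\<lambda>s. integral {0..s} g) \<le> (\<Sum>i<n. K (p (Suc i)) - K (p i))"
    unfolding variation_sum_def p_def[symmetric] by (intro sum_mono) auto
  also have "\<dots> = K t"
    unfolding sum_lessThan_telescope[of "\<lambda>i. K (p i)"] up(2,3) by (simp add: K_def)
  also have "\<dots> \<le> K T"
    unfolding K_def using t gi(2) by (intro integral_subset_le) (auto intro: integrable_subinterval_real)
  finally show ?thesis by (simp add: K_def)
qed

lemma variation_sum_cong:
  assumes t: "0 \<le> t" and eq: "\<And>s. s \<in> {0..t} \<Longrightarrow> F s = G s"
  shows "variation_sum n t F = variation_sum n t G"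
  unfolding variation_sum_def
proof (rule sum.cong)
  fix i assume "i \<in> {..<n}"
  then have i: "i < n" and n: "0 < n" by auto
  note up = uniform_partition(1,4)[OF t n]
  have "F (t * real i / n) = G (t * real i / n)" "F (t * real (Suc i) / n) = G (t * real (Suc i) / n)"
    by (intro eq up(2)[OF i, THEN conjunct1] atLeastAtMost_iff[THEN iffD2] conjI order_refl up(1))+
  then show "norm (F (t * real (Suc i) / n) - F (t * real i / n)) = norm (G (t * real (Suc i) / n) - G (t * real i / n))"
    by simp
qed simp

lemma variation_sum_diff_le:
  "variation_sum n t (\<lambda>s. F s - G s) \<le> variation_sum n t F + variation_sum n t G"
  unfolding variation_sum_def sum.distrib[symmetric]
proof (rule sum_mono)
  fix i
  show "norm (F (t * real (Suc i) / n) - G (t * real (Suc i) / n) - (F (t * real i / n) - G (t * real i / n)))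
    \<le> norm (F (t * real (Suc i) / n) - F (t * real i / n)) + norm (G (t * real (Suc i) / n) - G (t * real i / n))"
    using norm_triangle_ineq4[of "F (t * real (Suc i) / n) - F (t * real i / n)" "G (t * real (Suc i) / n) - G (t * real i / n)"]
    by (simp add: algebra_simps)
qed

text \<open>The equation of a single path, with the flow of laws \<open>\<mu>\<close> as a given
  datum: two solutions are compared as paths for two possibly different flows. The integral is the
  gauge integral, in which the estimates above are stated.\<close>

definition path_solution ::
  "real \<Rightarrow> (real \<Rightarrow> 'a::euclidean_space \<Rightarrow> 'a measure \<Rightarrow> 'a) \<Rightarrow> (real \<Rightarrow> 'a measure) \<Rightarrow> (real \<Rightarrow> 'a) \<Rightarrow> (real \<Rightarrow> 'a) \<Rightarrow> bool" where
  "path_solution T B \<mu> x y \<longleftrightarrow> (\<lambda>s. B s (x s) (\<mu> s)) absolutely_integrable_on {0..T} \<and>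
     (\<forall>t\<in>{0..T}. x t = integral {0..t} (\<lambda>s. B s (x s) (\<mu> s)) + y t)"

lemma set_integrable_lborel_absolutely_integrable:
  fixes f :: "real \<Rightarrow> 'a::euclidean_space"
  assumes "set_integrable lborel {a..b} f"
  shows "f absolutely_integrable_on {a..b}"
  using assms unfolding set_integrable_def by (intro integrable_completion[THEN iffD2]) auto

lemma weak_solution_path_solution:
  assumes "weak_solution T p B \<mu>Y M X Y"
  shows "AE \<omega> in M. path_solution T B (law_at M X) (apply_bcontfun (X \<omega>)) (apply_bcontfun (Y \<omega>))"
proof -
  have "AE \<omega> in M. set_integrable lborel {0..T} (\<lambda>t. B t (apply_bcontfun (X \<omega>) t) (law_at M X t))"
    "AE \<omega> in M. \<forall>t\<in>{0..T}. apply_bcontfun (X \<omega>) t =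
        (LINT s:{0..t}|lborel. B s (apply_bcontfun (X \<omega>) s) (law_at M X s)) + apply_bcontfun (Y \<omega>) t"
    using assms unfolding weak_solution_def by auto
  then show ?thesis
  proof eventually_elim
    case (elim \<omega>)
    have "(LINT s:{0..t}|lborel. B s (apply_bcontfun (X \<omega>) s) (law_at M X s))
        = integral {0..t} (\<lambda>s. B s (apply_bcontfun (X \<omega>) s) (law_at M X s))" if "t \<in> {0..T}" for t
      using that by (intro set_borel_integral_eq_integral set_integrable_subset[OF elim(1)]) auto
    then show ?case
      using elim(2) set_integrable_lborel_absolutely_integrable[OF elim(1)] by (simp add: path_solution_def)
  qed
qed

text \<open>
  Measurability of the total drift \<open>\<integral> |B\<^sub>s(X\<^sub>s, law X\<^sub>s)| ds\<close> would need measurability of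
  \<open>s \<mapsto> law X\<^sub>s\<close> for the Wasserstein topology.  The variation of \<open>X - Y\<close> does the same job and
  is a countable supremum of measurable functions.
\<close>

definition variation_le :: "real \<Rightarrow> 'w measure \<Rightarrow> ('w \<Rightarrow> (real \<Rightarrow>\<^sub>C 'a::euclidean_space)) \<Rightarrow>
    ('w \<Rightarrow> (real \<Rightarrow>\<^sub>C 'a)) \<Rightarrow> nat \<Rightarrow> 'w set" where
  "variation_le T M X Y n = {\<omega> \<in> space M. \<forall>k. \<forall>r::rat.
     variation_sum k (max 0 (min T (of_rat r))) (\<lambda>s. apply_bcontfun (X \<omega>) s - apply_bcontfun (Y \<omega>) s) \<le> real n}"

text \<open>For fixed \<open>k\<close> the variation sum is continuous in its time argument, so
  rational times suffice. The clamping makes every rational admissible and leaves \<open>t\<close>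
  unchanged.\<close>

lemma variation_leD:
  assumes "\<omega> \<in> variation_le T M X Y n" "t \<in> {0..T}"
  shows "variation_sum k t (\<lambda>s. apply_bcontfun (X \<omega>) s - apply_bcontfun (Y \<omega>) s) \<le> real n"
proof -
  let ?f = "\<lambda>q. variation_sum k (max 0 (min T q)) (\<lambda>s. apply_bcontfun (X \<omega>) s - apply_bcontfun (Y \<omega>) s)"
  have "?f t \<le> real n"
  proof (rule continuous_le_on_closure[where f="?f" and S="\<rat>"])
    show "continuous_on (closure \<rat>) ?f"
      unfolding variation_sum_def divide_inverse
      by (intro continuous_intros continuous_on_compose2[OF continuous_on_apply_bcontfun[of UNIV]]) auto
    show "t \<in> closure \<rat>" by (simp add: Rats_closure_real)
  qed (use assms(1) in \<open>auto simp: variation_le_def Rats_def\<close>)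
  then show ?thesis using assms(2) by (simp add: max_def min_def split: if_splits)
qed

lemma incseq_variation_le: "incseq (variation_le T M X Y)"
  unfolding incseq_def variation_le_def by (safe; rule order_trans[OF _ of_nat_mono]; simp)

lemma sets_variation_le:
  assumes "X \<in> measurable M (CT_borel T)" "Y \<in> measurable M (CT_borel T)"
  shows "variation_le T M X Y n \<in> sets M"
proof -
  note [measurable] = measurable_CT_borelD(3)[OF assms(1)] measurable_CT_borelD(3)[OF assms(2)]
  show ?thesis unfolding variation_le_def variation_sum_def by measurable
qed

text \<open>For almost every sample point \<open>X - Y\<close> is an indefinite integral, with
  variation at most the finite total drift; \<open>n\<close> is any integer above it and depends on
  the sample point.\<close>

lemma AE_variation_le:
  assumes "0 < T" and ws: "weak_solution T p B \<mu>Y M X Y"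
  shows "AE \<omega> in M. \<exists>n. \<omega> \<in> variation_le T M X Y n"
  using weak_solution_path_solution[OF ws] AE_space
proof eventually_elim
  case (elim \<omega>)
  define g where "g = (\<lambda>s. B s (apply_bcontfun (X \<omega>) s) (law_at M X s))"
  have g: "g absolutely_integrable_on {0..T}"
    "\<And>t. t \<in> {0..T} \<Longrightarrow> apply_bcontfun (X \<omega>) t - apply_bcontfun (Y \<omega>) t = integral {0..t} g"
    using elim(1) by (auto simp: path_solution_def g_def)
  obtain n :: nat where n: "integral {0..T} (\<lambda>s. norm (g s)) \<le> real n" using real_arch_simple by blast
  have "variation_sum k (max 0 (min T q)) (\<lambda>s. apply_bcontfun (X \<omega>) s - apply_bcontfun (Y \<omega>) s) \<le> real n" for k q
  proof -
    have t: "max 0 (min T q) \<in> {0..T}" (is "?t \<in> _") using assms(1) by auto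
    have "variation_sum k ?t (\<lambda>s. apply_bcontfun (X \<omega>) s - apply_bcontfun (Y \<omega>) s) = variation_sum k ?t (\<lambda>s. integral {0..s} g)"
      using t g(2) by (intro variation_sum_cong) auto
    then show ?thesis using variation_sum_integral_le[OF g(1) t, of k] n by simp
  qed
  then show ?case using elim(2) by (auto simp: variation_le_def)
qed

subsection \<open>Uniqueness\<close>

lemma exists_input_tolerance:
  fixes R \<sigma> :: real
  assumes "0 < \<sigma>" "0 \<le> R"
  obtains \<epsilon> where "0 < \<epsilon>" "\<epsilon> \<le> \<sigma>" "4 * (\<epsilon> * (2 * R)) \<le> \<sigma>\<^sup>2"
proof -
  \<comment> \<open>The two entries answer the two constraints on \<epsilon>; \<open>R + 1\<close>
    keeps the denominator positive for \<open>R = 0\<close>.\<close>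
  define \<epsilon> where "\<epsilon> = min \<sigma> (\<sigma>\<^sup>2 / (8 * (R + 1)))"
  have "\<epsilon> * (R + 1) \<le> \<sigma>\<^sup>2 / (8 * (R + 1)) * (R + 1)"
    using assms by (intro mult_right_mono) (auto simp: \<epsilon>_def)
  also have "\<dots> = \<sigma>\<^sup>2 / 8" using assms by (simp add: field_simps)
  finally have "\<epsilon> * (R + 1) \<le> \<sigma>\<^sup>2 / 8" .
  moreover have \<epsilon>: "0 < \<epsilon>" "\<epsilon> \<le> \<sigma>" using assms by (auto simp: \<epsilon>_def)
  ultimately have "4 * (\<epsilon> * (2 * R)) \<le> \<sigma>\<^sup>2" by (simp add: distrib_left)
  with \<epsilon> show thesis by (rule that)
qed

section \<open>Two paths under the monotonicity condition\<close>

locale monotone_drift =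
  fixes T p :: real
    and B :: "real \<Rightarrow> 'a::euclidean_space \<Rightarrow> 'a measure \<Rightarrow> 'a"
    and h :: "real \<Rightarrow> real"
  assumes T: "0 < T" and p: "0 < p"
    and h: "h absolutely_integrable_on {0<..<T}"
    and mono: "\<And>t x y \<mu> \<nu>. t \<in> {0..T} \<Longrightarrow> \<mu> \<in> Pp p borel \<Longrightarrow> \<nu> \<in> Pp p borel \<Longrightarrow>
           (x - y) \<bullet> (B t x \<mu> - B t y \<nu>)
             \<le> h t * ((norm (x - y))\<^sup>2 + norm (x - y) * wasserstein p \<mu> \<nu>)"
begin

lemma abs_h: "(\<lambda>s. \<bar>h s\<bar>) integrable_on {0..T}"
proof -
  have "(\<lambda>s. \<bar>h s\<bar>) integrable_on {0<..<T}"
    using h by (simp add: absolutely_integrable_on_def)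
  then show ?thesis by (simp add: integrable_on_Icc_iff_Ioo)
qed

text \<open>Uniform continuity of the indefinite integral of \<open>|h|\<close> makes its increments
  small on a fine uniform grid; \<open>1 / 16\<close> is the mass that \<open>norm_step\<close> asks
  for.\<close>

lemma obtain_grid:
  obtains q :: "nat \<Rightarrow> real" and N where "q 0 = 0" "q N = T" "mono q"
    "\<And>i. i < N \<Longrightarrow> integral {q i..q (Suc i)} (\<lambda>s. \<bar>h s\<bar>) \<le> 1 / 16"
proof -
  define K where "K s = integral {0..s} (\<lambda>s. \<bar>h s\<bar>)" for s
  have "continuous_on {0..T} K"
    unfolding K_def using abs_h by (rule indefinite_integral_continuous_1)
  then obtain n :: nat where n: "0 < n" "\<And>x y. x \<in> {0..T} \<Longrightarrow> y \<in> {0..T} \<Longrightarrow> \<bar>x - y\<bar> \<le> T / n \<Longrightarrow> dist (K x) (K y) \<le> 1 / 16"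
    using exists_fine_partition[of T K "1 / 16"] T by auto
  define q where "q i = T * real i / n" for i
  note up = uniform_partition[OF less_imp_le[OF T] n(1), folded q_def]
  show thesis
  proof (rule that[of q n])
    fix i assume i: "i < n"
    have m: "q i \<in> {0..T}" "q (Suc i) \<in> {0..T}" "\<bar>q (Suc i) - q i\<bar> \<le> T / n"
      using up(4)[OF i, of "q i"] up(4)[OF i, of "q (Suc i)"] up(1)[of i] by auto
    have "integral {0..q i} (\<lambda>s. \<bar>h s\<bar>) + integral {q i..q (Suc i)} (\<lambda>s. \<bar>h s\<bar>) = integral {0..q (Suc i)} (\<lambda>s. \<bar>h s\<bar>)"
      using m up(1)[of i] abs_h
      by (intro Henstock_Kurzweil_Integration.integral_combine integrable_subinterval_real[OF abs_h]) auto
    then have "integral {q i..q (Suc i)} (\<lambda>s. \<bar>h s\<bar>) = K (q (Suc i)) - K (q i)" by (simp add: K_def)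
    also have "\<dots> \<le> 1 / 16" using n(2)[OF m(2,1,3)] unfolding dist_real_def by linarith
    finally show "integral {q i..q (Suc i)} (\<lambda>s. \<bar>h s\<bar>) \<le> 1 / 16" .
  qed (use up in \<open>auto simp: mono_iff_le_Suc\<close>)
qed

text \<open>The drift integral of each path is its difference from its input, so the variation
  bounds of the two paths add up to \<open>2 * R\<close>.\<close>

lemma path_perturbed_integral:
  fixes y1 y2 :: "real \<Rightarrow>\<^sub>C 'a"
  assumes sol: "path_solution T B \<mu>1 (apply_bcontfun x1) (apply_bcontfun y1)"
      "path_solution T B \<mu>2 (apply_bcontfun x2) (apply_bcontfun y2)"
    and var: "\<And>n t. t \<in> {0..T} \<Longrightarrow> variation_sum n t (\<lambda>s. apply_bcontfun x1 s - apply_bcontfun y1 s) \<le> R"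
      "\<And>n t. t \<in> {0..T} \<Longrightarrow> variation_sum n t (\<lambda>s. apply_bcontfun x2 s - apply_bcontfun y2 s) \<le> R"
    and near: "dist y1 y2 \<le> \<epsilon>"
    and \<sigma>: "0 \<le> \<sigma>" "\<epsilon> \<le> \<sigma>" "4 * (\<epsilon> * (2 * R)) \<le> \<sigma>\<^sup>2"
  shows "perturbed_integral T \<epsilon> (2 * R) \<sigma>
    (\<lambda>s. B s (apply_bcontfun x1 s) (\<mu>1 s) - B s (apply_bcontfun x2 s) (\<mu>2 s))
    (\<lambda>s. apply_bcontfun y1 s - apply_bcontfun y2 s) (\<lambda>s. apply_bcontfun x1 s - apply_bcontfun x2 s) (\<lambda>s. \<bar>h s\<bar>)"
proof
  let ?b1 = "\<lambda>s. B s (apply_bcontfun x1 s) (\<mu>1 s)" and ?b2 = "\<lambda>s. B s (apply_bcontfun x2 s) (\<mu>2 s)"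
  have b: "?b1 absolutely_integrable_on {0..T}" "?b2 absolutely_integrable_on {0..T}"
    using sol by (auto simp: path_solution_def)
  show "(\<lambda>s. ?b1 s - ?b2 s) absolutely_integrable_on {0..T}"
    using b by (rule set_integral_diff(1))
  have bi: "?b1 integrable_on {0..s}" "?b2 integrable_on {0..s}" if "s \<in> {0..T}" for s
    using b that by (auto simp: absolutely_integrable_on_def intro: integrable_subinterval_real)
  have eq: "integral {0..s} (\<lambda>s. ?b1 s - ?b2 s) = (apply_bcontfun x1 s - apply_bcontfun y1 s) - (apply_bcontfun x2 s - apply_bcontfun y2 s)"
    if "s \<in> {0..T}" for s
    using sol that bi[OF that] by (simp add: path_solution_def Henstock_Kurzweil_Integration.integral_diff)
  show "continuous_on {0..T} (\<lambda>s. apply_bcontfun y1 s - apply_bcontfun y2 s)"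
    by (intro continuous_on_diff continuous_on_apply_bcontfun)
  show "norm (apply_bcontfun y1 s - apply_bcontfun y2 s) \<le> \<epsilon>" for s
    using dist_bounded[of y1 s y2] near by (simp add: dist_norm)
  show "apply_bcontfun x1 s - apply_bcontfun x2 s = integral {0..s} (\<lambda>s. ?b1 s - ?b2 s) + (apply_bcontfun y1 s - apply_bcontfun y2 s)"
    if "s \<in> {0..T}" for s
    using eq[OF that] by simp
  show "variation_sum n t (\<lambda>s. integral {0..s} (\<lambda>s. ?b1 s - ?b2 s)) \<le> 2 * R" if t: "t \<in> {0..T}" for n t
  proof -
    have "variation_sum n t (\<lambda>s. integral {0..s} (\<lambda>s. ?b1 s - ?b2 s)) = variation_sum n t
        (\<lambda>s. (apply_bcontfun x1 s - apply_bcontfun y1 s) - (apply_bcontfun x2 s - apply_bcontfun y2 s))"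
      using t by (intro variation_sum_cong eq) auto
    also have "\<dots> \<le> R + R"
      by (rule order_trans[OF variation_sum_diff_le add_mono[OF var(1)[OF t] var(2)[OF t]]])
    finally show ?thesis by simp
  qed
qed (use abs_h \<sigma> in auto)

text \<open>\<open>h\<close> may be negative, and then replacing the distance by an upper bound
  would go the wrong way. With \<open>|h|\<close> the right-hand side increases with
  \<open>m\<close>.\<close>

lemma dissipative:
  assumes "t \<in> {0..T}" "\<mu> \<in> Pp p borel" "\<nu> \<in> Pp p borel" "wasserstein p \<mu> \<nu> \<le> m"
  shows "(x - y) \<bullet> (B t x \<mu> - B t y \<nu>) \<le> \<bar>h t\<bar> * ((norm (x - y))\<^sup>2 + norm (x - y) * m)"
proof -
  have W: "0 \<le> wasserstein p \<mu> \<nu>" by (simp add: wasserstein_def)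
  have "h t * ((norm (x - y))\<^sup>2 + norm (x - y) * wasserstein p \<mu> \<nu>)
      \<le> \<bar>h t\<bar> * ((norm (x - y))\<^sup>2 + norm (x - y) * m)"
    using assms(4) W by (intro mult_mono add_left_mono mult_left_mono) auto
  then show ?thesis using mono[OF assms(1-3), of x y] by linarith
qed

text \<open>Where the marginals have distance 0, the monotonicity condition loses its second term
  and \<open>norm_grid\<close> applies. The factor \<open>8 ^ j\<close> is harmless because \<sigma>
  can be chosen after the grid.\<close>

lemma path_distance_grid:
  assumes per: "perturbed_integral T \<epsilon> R \<sigma>
    (\<lambda>s. B s (apply_bcontfun x1 s) (\<mu>1 s) - B s (apply_bcontfun x2 s) (\<mu>2 s)) e
    (\<lambda>s. apply_bcontfun x1 s - apply_bcontfun x2 s) (\<lambda>s. \<bar>h s\<bar>)"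
    and \<mu>: "\<And>t. t \<in> {0..T} \<Longrightarrow> \<mu>1 t \<in> Pp p borel" "\<And>t. t \<in> {0..T} \<Longrightarrow> \<mu>2 t \<in> Pp p borel"
    and q: "q 0 = 0" "mono q" "\<And>i. i \<le> j \<Longrightarrow> q i \<le> T"
    and small: "\<And>i. i < j \<Longrightarrow> integral {q i..q (Suc i)} (\<lambda>s. \<bar>h s\<bar>) \<le> 1 / 16"
    and W0: "\<And>s. s \<in> {0..q j} \<Longrightarrow> wasserstein p (\<mu>1 s) (\<mu>2 s) = 0"
    and t: "t \<in> {0..q j}"
  shows "norm (apply_bcontfun x1 t - apply_bcontfun x2 t) \<le> 8 ^ j * \<sigma>"
proof -
  interpret perturbed_integral T \<epsilon> R \<sigma>
    "\<lambda>s. B s (apply_bcontfun x1 s) (\<mu>1 s) - B s (apply_bcontfun x2 s) (\<mu>2 s)" e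
    "\<lambda>s. apply_bcontfun x1 s - apply_bcontfun x2 s" "\<lambda>s. \<bar>h s\<bar>"
    by (rule per)
  have "\<forall>s\<in>{0..q j}. norm (apply_bcontfun x1 s - apply_bcontfun x2 s) \<le> 8 ^ j * \<sigma>"
  proof (rule norm_grid[OF q small])
    fix s assume s: "s \<in> {0..q j}"
    then have "s \<in> {0..T}" using q(3)[of j] by auto
    then show "(apply_bcontfun x1 s - apply_bcontfun x2 s) \<bullet> (B s (apply_bcontfun x1 s) (\<mu>1 s) - B s (apply_bcontfun x2 s) (\<mu>2 s))
       \<le> \<bar>h s\<bar> * (norm (apply_bcontfun x1 s - apply_bcontfun x2 s))\<^sup>2"
      using dissipative[OF _ \<mu>(1) \<mu>(2), of s s s 0 "apply_bcontfun x1 s" "apply_bcontfun x2 s"] W0[OF s] by simp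
  qed auto
  then show ?thesis using t by blast
qed

text \<open>\<open>path_distance_grid\<close> controls the difference at \<open>q j\<close>, and
  \<open>norm_step\<close> turns the bound \<open>m\<close> on the next interval into
  \<open>m / 2\<close> up to a multiple of \<sigma>.\<close>

lemma path_distance_step:
  assumes per: "perturbed_integral T \<epsilon> R \<sigma>
    (\<lambda>s. B s (apply_bcontfun x1 s) (\<mu>1 s) - B s (apply_bcontfun x2 s) (\<mu>2 s)) e
    (\<lambda>s. apply_bcontfun x1 s - apply_bcontfun x2 s) (\<lambda>s. \<bar>h s\<bar>)"
    and \<mu>: "\<And>t. t \<in> {0..T} \<Longrightarrow> \<mu>1 t \<in> Pp p borel" "\<And>t. t \<in> {0..T} \<Longrightarrow> \<mu>2 t \<in> Pp p borel"
    and q: "q 0 = 0" "mono q" "\<And>i. i \<le> Suc j \<Longrightarrow> q i \<le> T"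
    and small: "\<And>i. i < Suc j \<Longrightarrow> integral {q i..q (Suc i)} (\<lambda>s. \<bar>h s\<bar>) \<le> 1 / 16"
    and W0: "\<And>s. s \<in> {0..q j} \<Longrightarrow> wasserstein p (\<mu>1 s) (\<mu>2 s) = 0"
    and m: "0 \<le> m" "\<And>s. s \<in> {q j..q (Suc j)} \<Longrightarrow> wasserstein p (\<mu>1 s) (\<mu>2 s) \<le> m"
    and t: "t \<in> {q j..q (Suc j)}"
  shows "norm (apply_bcontfun x1 t - apply_bcontfun x2 t) \<le> m / 2 + 8 ^ Suc j * \<sigma>"
proof -
  interpret perturbed_integral T \<epsilon> R \<sigma>
    "\<lambda>s. B s (apply_bcontfun x1 s) (\<mu>1 s) - B s (apply_bcontfun x2 s) (\<mu>2 s)" e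
    "\<lambda>s. apply_bcontfun x1 s - apply_bcontfun x2 s" "\<lambda>s. \<bar>h s\<bar>"
    by (rule per)
  have qj: "0 \<le> q j" "q j \<le> q (Suc j)" using q(1,2) by (metis monoD le0, simp add: monoD)
  have "norm (apply_bcontfun x1 (q j) - apply_bcontfun x2 (q j)) \<le> 8 ^ j * \<sigma>"
    using q small W0 qj by (intro path_distance_grid[OF per \<mu>, of q]) auto
  moreover have "norm (apply_bcontfun x1 t - apply_bcontfun x2 t)
      \<le> m / 2 + 2 * norm (apply_bcontfun x1 (q j) - apply_bcontfun x2 (q j)) + 6 * \<sigma>"
  proof (rule norm_step[OF qj _ _ m(1) _ t])
    fix s assume s: "s \<in> {q j..q (Suc j)}"
    then have "s \<in> {0..T}" using q(3)[of "Suc j"] qj by auto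
    then show "(apply_bcontfun x1 s - apply_bcontfun x2 s) \<bullet> (B s (apply_bcontfun x1 s) (\<mu>1 s) - B s (apply_bcontfun x2 s) (\<mu>2 s))
       \<le> \<bar>h s\<bar> * ((norm (apply_bcontfun x1 s - apply_bcontfun x2 s))\<^sup>2 + norm (apply_bcontfun x1 s - apply_bcontfun x2 s) * m)"
      by (intro dissipative \<mu> m(2)[OF s])
  qed (use q small in auto)
  moreover have "1 * \<sigma> \<le> 8 ^ j * \<sigma>" using \<sigma>(1) by (intro mult_right_mono) auto
  ultimately show ?thesis unfolding power_Suc mult.assoc by linarith
qed

end

section \<open>Weak solutions as random paths\<close>

lemma weak_solutionD:
  assumes "weak_solution T p B \<mu>Y M X Y"
  shows "prob_space M" "X \<in> measurable M (CT_borel T)" "Y \<in> measurable M (CT_borel T)"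
    "distr M (CT_borel T) Y = \<mu>Y" "\<And>t. t \<in> {0..T} \<Longrightarrow> law_at M X t \<in> Pp p borel"
    "bdd_above ((\<lambda>t. pnorm p (law_at M X t)) ` {0..T})"
  using assms unfolding weak_solution_def by auto

lemma weak_solution_moment:
  fixes X :: "'w \<Rightarrow> real \<Rightarrow>\<^sub>C 'a::euclidean_space"
  assumes ws: "weak_solution T p B \<mu>Y M X Y" and p: "0 < p"
  shows "t \<in> {0..T} \<Longrightarrow> integrable M (\<lambda>\<omega>. norm (apply_bcontfun (X \<omega>) t) powr p)"
    and "\<exists>C. \<forall>t\<in>{0..T}. (\<integral>\<omega>. norm (apply_bcontfun (X \<omega>) t) powr p \<partial>M) \<le> C"
proof -
  note [measurable] = measurable_CT_borelD(3)[OF weak_solutionD(2)[OF ws]]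
  show "integrable M (\<lambda>\<omega>. norm (apply_bcontfun (X \<omega>) t) powr p)" if "t \<in> {0..T}"
    using weak_solutionD(5)[OF ws that] unfolding Pp_def by (simp add: integrable_distr_eq)
  obtain c where c: "\<And>t. t \<in> {0..T} \<Longrightarrow> pnorm p (law_at M X t) \<le> c"
    using weak_solutionD(6)[OF ws] unfolding bdd_above_def by (metis image_eqI)
  have "(\<integral>\<omega>. norm (apply_bcontfun (X \<omega>) t) powr p \<partial>M) \<le> c powr p" if t: "t \<in> {0..T}" for t
  proof -
    let ?I = "\<integral>\<omega>. norm (apply_bcontfun (X \<omega>) t) powr p \<partial>M"
    have "?I powr (1 / p) \<le> c" using c[OF t] unfolding pnorm_def by (simp add: integral_distr)
    then have "(?I powr (1 / p)) powr p \<le> c powr p" using p by (intro powr_mono2) auto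
    then show ?thesis using p by (simp add: powr_powr integral_nonneg)
  qed
  then show "\<exists>C. \<forall>t\<in>{0..T}. (\<integral>\<omega>. norm (apply_bcontfun (X \<omega>) t) powr p \<partial>M) \<le> C" by blast
qed

lemma equal_inputs_weak_solutions:
  assumes T: "0 < T" and ws1: "weak_solution T p B \<mu>Y M1 X1 Y1" and ws2: "weak_solution T p B \<mu>Y M2 X2 Y2"
  shows "equal_inputs T M1 M2 Y1 Y2 (variation_le T M1 X1 Y1) (variation_le T M2 X2 Y2)
    (\<lambda>\<omega>. path_solution T B (law_at M1 X1) (apply_bcontfun (X1 \<omega>)) (apply_bcontfun (Y1 \<omega>)))
    (\<lambda>\<omega>. path_solution T B (law_at M2 X2) (apply_bcontfun (X2 \<omega>)) (apply_bcontfun (Y2 \<omega>)))"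
proof -
  note D1 = weak_solutionD[OF ws1] and D2 = weak_solutionD[OF ws2]
  have Y_eq: "distr M1 (CT_borel T) Y1 = distr M2 (CT_borel T) Y2" by (simp add: D1(4) D2(4))
  show ?thesis
    by (rule equal_inputs.intro[OF T D1(1) D2(1) D1(3) D2(3) Y_eq
          sets_variation_le[OF D1(2,3)] incseq_variation_le AE_variation_le[OF T ws1]
          sets_variation_le[OF D2(2,3)] incseq_variation_le AE_variation_le[OF T ws2]
          weak_solution_path_solution[OF ws1] weak_solution_path_solution[OF ws2]])
qed

section \<open>Passage from paths to laws\<close>

context monotone_drift
begin

text \<open>Provides the finite constant from which the halving in \<open>laws_unique_grid\<close>
  starts. Any coupling serves, as the moments are bounded uniformly in time; the tolerance 1 below
  is arbitrary.\<close>

lemma wasserstein_bounded: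
  assumes ws1: "weak_solution T p B \<mu>Y M1 X1 Y1" and ws2: "weak_solution T p B \<mu>Y M2 X2 Y2"
  obtains C where "0 \<le> C" "\<And>t. t \<in> {0..T} \<Longrightarrow> wasserstein p (law_at M1 X1 t) (law_at M2 X2 t) \<le> C"
proof -
  interpret equal_inputs T M1 M2 Y1 Y2 "variation_le T M1 X1 Y1" "variation_le T M2 X2 Y2"
    "\<lambda>\<omega>. path_solution T B (law_at M1 X1) (apply_bcontfun (X1 \<omega>)) (apply_bcontfun (Y1 \<omega>))"
    "\<lambda>\<omega>. path_solution T B (law_at M2 X2) (apply_bcontfun (X2 \<omega>)) (apply_bcontfun (Y2 \<omega>))"
    by (rule equal_inputs_weak_solutions[OF T ws1 ws2])
  obtain \<pi> where \<pi>: "sets \<pi> = sets (M1 \<Otimes>\<^sub>M M2)" "distr \<pi> M1 fst = M1" "distr \<pi> M2 snd = M2"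
    using obtain_coupling[of 1] by auto
  obtain C1 where C1: "\<And>t. t \<in> {0..T} \<Longrightarrow> (\<integral>\<omega>. norm (apply_bcontfun (X1 \<omega>) t) powr p \<partial>M1) \<le> C1"
    using weak_solution_moment(2)[OF ws1 p] by blast
  obtain C2 where C2: "\<And>t. t \<in> {0..T} \<Longrightarrow> (\<integral>\<omega>. norm (apply_bcontfun (X2 \<omega>) t) powr p \<partial>M2) \<le> C2"
    using weak_solution_moment(2)[OF ws2 p] by blast
  have "wasserstein p (law_at M1 X1 t) (law_at M2 X2 t) \<le> (2 powr p * C1 + 2 powr p * C2) powr (1 / p)"
    if t: "t \<in> {0..T}" for t
  proof -
    note i = weak_solution_moment(1)[OF ws1 p t] weak_solution_moment(1)[OF ws2 p t]
    have "wasserstein p (law_at M1 X1 t) (law_at M2 X2 t) \<le>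
      (0 + (\<integral>\<omega>. 2 powr p * norm (apply_bcontfun (X1 \<omega>) t) powr p \<partial>M1)
         + (\<integral>\<omega>. 2 powr p * norm (apply_bcontfun (X2 \<omega>) t) powr p \<partial>M2)) powr (1 / p)"
    proof (rule wasserstein_le_coupling[OF M1 \<pi>])
      show "AE z in \<pi>. norm (apply_bcontfun (X1 (fst z)) t - apply_bcontfun (X2 (snd z)) t) powr p
          \<le> 0 + 2 powr p * norm (apply_bcontfun (X1 (fst z)) t) powr p + 2 powr p * norm (apply_bcontfun (X2 (snd z)) t) powr p"
        using norm_diff_powr_le[OF p] by (intro AE_I2) (simp add: distrib_left)
    qed (use i p weak_solutionD(2)[OF ws1] weak_solutionD(2)[OF ws2] in \<open>auto intro: measurable_CT_borelD(3)\<close>)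
    also have "\<dots> \<le> (2 powr p * C1 + 2 powr p * C2) powr (1 / p)"
      using C1[OF t] C2[OF t] p
      by (intro powr_mono2) (auto intro!: add_mono add_nonneg_nonneg Bochner_Integration.integral_nonneg)
    finally show ?thesis .
  qed
  then show thesis by (rule that[OF powr_ge_zero])
qed

text \<open>Induction along the grid. On the next interval any bound \<open>m\<close> for the
  distance of the marginals can be replaced by \<open>m / 2\<close>, so the finite bound of
  \<open>wasserstein_bounded\<close> is driven to 0.\<close>

lemma laws_unique_grid:
  assumes ws1: "weak_solution T p B \<mu>Y M1 X1 Y1" and ws2: "weak_solution T p B \<mu>Y M2 X2 Y2"
    and q: "q 0 = 0" "mono q" "\<And>i. i \<le> N \<Longrightarrow> q i \<le> T"
    and small: "\<And>i. i < N \<Longrightarrow> integral {q i..q (Suc i)} (\<lambda>s. \<bar>h s\<bar>) \<le> 1 / 16"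
  shows "j \<le> N \<Longrightarrow> \<forall>s\<in>{0..q j}. wasserstein p (law_at M1 X1 s) (law_at M2 X2 s) = 0"
proof (induction j)
  case 0
  interpret equal_inputs T M1 M2 Y1 Y2 "variation_le T M1 X1 Y1" "variation_le T M2 X2 Y2"
    "\<lambda>\<omega>. path_solution T B (law_at M1 X1) (apply_bcontfun (X1 \<omega>)) (apply_bcontfun (Y1 \<omega>))"
    "\<lambda>\<omega>. path_solution T B (law_at M2 X2) (apply_bcontfun (X2 \<omega>)) (apply_bcontfun (Y2 \<omega>))"
    by (rule equal_inputs_weak_solutions[OF T ws1 ws2])
  have T0: "0 \<in> {0..T}" using T by auto
  \<comment> \<open>At time 0 the drift integral vanishes, so the solutions equal their inputs and
    are as close as these.\<close>
  have "wasserstein p (law_at M1 X1 0) (law_at M2 X2 0) \<le> 0"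
  proof (rule wasserstein_le[OF _ _ _ _ p])
    fix n and \<tau> :: real assume \<tau>: "0 < \<tau>"
    have "norm (apply_bcontfun (X1 \<omega>1) 0 - apply_bcontfun (X2 \<omega>2) 0) \<le> 0 + \<tau>"
      if "path_solution T B (law_at M1 X1) (apply_bcontfun (X1 \<omega>1)) (apply_bcontfun (Y1 \<omega>1))"
        "path_solution T B (law_at M2 X2) (apply_bcontfun (X2 \<omega>2)) (apply_bcontfun (Y2 \<omega>2))"
        "dist (Y1 \<omega>1) (Y2 \<omega>2) \<le> \<tau>" for \<omega>1 \<omega>2
      using that(1,2) T0 dist_bounded[of "Y1 \<omega>1" 0 "Y2 \<omega>2"] that(3)
      by (auto simp: path_solution_def dist_norm)
    then show "\<exists>\<epsilon>>0. \<forall>\<omega>1\<in>variation_le T M1 X1 Y1 n. \<forall>\<omega>2\<in>variation_le T M2 X2 Y2 n.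
        path_solution T B (law_at M1 X1) (apply_bcontfun (X1 \<omega>1)) (apply_bcontfun (Y1 \<omega>1)) \<longrightarrow>
        path_solution T B (law_at M2 X2) (apply_bcontfun (X2 \<omega>2)) (apply_bcontfun (Y2 \<omega>2)) \<longrightarrow>
        dist (Y1 \<omega>1) (Y2 \<omega>2) \<le> \<epsilon> \<longrightarrow> norm (apply_bcontfun (X1 \<omega>1) 0 - apply_bcontfun (X2 \<omega>2) 0) \<le> 0 + \<tau>"
      using \<tau> by blast
  qed (use weak_solution_moment(1)[OF ws1 p T0] weak_solution_moment(1)[OF ws2 p T0]
      weak_solutionD(2)[OF ws1] weak_solutionD(2)[OF ws2] in \<open>auto intro: measurable_CT_borelD(3)\<close>)
  moreover have "0 \<le> wasserstein p (law_at M1 X1 0) (law_at M2 X2 0)" by (simp add: wasserstein_def)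
  ultimately show ?case by (simp add: q(1))
next
  case (Suc j)
  interpret equal_inputs T M1 M2 Y1 Y2 "variation_le T M1 X1 Y1" "variation_le T M2 X2 Y2"
    "\<lambda>\<omega>. path_solution T B (law_at M1 X1) (apply_bcontfun (X1 \<omega>)) (apply_bcontfun (Y1 \<omega>))"
    "\<lambda>\<omega>. path_solution T B (law_at M2 X2) (apply_bcontfun (X2 \<omega>)) (apply_bcontfun (Y2 \<omega>))"
    by (rule equal_inputs_weak_solutions[OF T ws1 ws2])
  let ?W = "\<lambda>s. wasserstein p (law_at M1 X1 s) (law_at M2 X2 s)"
  have W0: "\<And>s. s \<in> {0..q j} \<Longrightarrow> ?W s = 0" using Suc by simp
  have qj: "0 \<le> q j" "q (Suc j) \<le> T" using q Suc.prems by (metis monoD le0, simp)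
  have halve: "\<forall>s\<in>{q j..q (Suc j)}. ?W s \<le> m / 2" if m: "0 \<le> m" "\<forall>s\<in>{q j..q (Suc j)}. ?W s \<le> m" for m
  proof
    fix s assume s: "s \<in> {q j..q (Suc j)}"
    then have sT: "s \<in> {0..T}" using qj by auto
    show "?W s \<le> m / 2"
    proof (rule wasserstein_le[OF _ _ _ _ p])
      fix n and \<tau> :: real assume \<tau>: "0 < \<tau>"
      \<comment> \<open>Scaled so that the factor accumulated along the grid leaves exactly \<tau>.
        The tolerance \<epsilon> then depends on \<sigma> and on the variation bound
        \<open>n\<close>.\<close>
      define \<sigma> where "\<sigma> = \<tau> / 8 ^ Suc j"
      have \<sigma>: "0 < \<sigma>" "8 ^ Suc j * \<sigma> = \<tau>" using \<tau> by (auto simp: \<sigma>_def)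
      obtain \<epsilon> where \<epsilon>: "0 < \<epsilon>" "\<epsilon> \<le> \<sigma>" "4 * (\<epsilon> * (2 * real n)) \<le> \<sigma>\<^sup>2"
        using exists_input_tolerance[OF \<sigma>(1), of "real n"] by auto
      have "norm (apply_bcontfun (X1 \<omega>1) s - apply_bcontfun (X2 \<omega>2) s) \<le> m / 2 + \<tau>"
        if v: "\<omega>1 \<in> variation_le T M1 X1 Y1 n" "\<omega>2 \<in> variation_le T M2 X2 Y2 n"
          and sol: "path_solution T B (law_at M1 X1) (apply_bcontfun (X1 \<omega>1)) (apply_bcontfun (Y1 \<omega>1))"
            "path_solution T B (law_at M2 X2) (apply_bcontfun (X2 \<omega>2)) (apply_bcontfun (Y2 \<omega>2))"
          and d: "dist (Y1 \<omega>1) (Y2 \<omega>2) \<le> \<epsilon>" for \<omega>1 \<omega>2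
        unfolding \<sigma>(2)[symmetric]
        by (rule path_distance_step[OF path_perturbed_integral[OF sol variation_leD[OF v(1)] variation_leD[OF v(2)] d less_imp_le[OF \<sigma>(1)] \<epsilon>(2,3)]
              weak_solutionD(5)[OF ws1] weak_solutionD(5)[OF ws2] q(1,2) _ _ W0 m(1) _ s])
          (use Suc.prems q small m in auto)
      then show "\<exists>\<epsilon>>0. \<forall>\<omega>1\<in>variation_le T M1 X1 Y1 n. \<forall>\<omega>2\<in>variation_le T M2 X2 Y2 n.
          path_solution T B (law_at M1 X1) (apply_bcontfun (X1 \<omega>1)) (apply_bcontfun (Y1 \<omega>1)) \<longrightarrow>
          path_solution T B (law_at M2 X2) (apply_bcontfun (X2 \<omega>2)) (apply_bcontfun (Y2 \<omega>2)) \<longrightarrow>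
          dist (Y1 \<omega>1) (Y2 \<omega>2) \<le> \<epsilon> \<longrightarrow> norm (apply_bcontfun (X1 \<omega>1) s - apply_bcontfun (X2 \<omega>2) s) \<le> m / 2 + \<tau>"
        using \<epsilon>(1) by blast
    qed (use weak_solution_moment(1)[OF ws1 p sT] weak_solution_moment(1)[OF ws2 p sT] m
      weak_solutionD(2)[OF ws1] weak_solutionD(2)[OF ws2] in \<open>auto intro: measurable_CT_borelD(3)\<close>)
  qed
  obtain C where C: "0 \<le> C" "\<And>t. t \<in> {0..T} \<Longrightarrow> ?W t \<le> C"
    using wasserstein_bounded[OF ws1 ws2] by blast
  have iter: "\<forall>s\<in>{q j..q (Suc j)}. ?W s \<le> C * (1 / 2) ^ i" for i
  proof (induction i)
    case 0
    then show ?case using C(2) qj by auto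
  next
    case (Suc i)
    have "0 \<le> C * (1 / 2) ^ i" using C(1) by simp
    from halve[OF this Suc.IH] show ?case by simp
  qed
  show ?case
  proof
    fix s assume s: "s \<in> {0..q (Suc j)}"
    show "?W s = 0"
    proof (cases "s \<le> q j")
      case True
      then show ?thesis using W0 s by auto
    next
      case False
      then have "s \<in> {q j..q (Suc j)}" using s by auto
      then have le: "?W s \<le> C * (1 / 2) ^ i" for i using iter by blast
      have "(\<lambda>i. C * (1 / 2) ^ i) \<longlonglongrightarrow> C * 0"
        by (intro tendsto_mult tendsto_const LIMSEQ_realpow_zero) auto
      then have "?W s \<le> C * 0"
        using le by (intro LIMSEQ_le_const[of "\<lambda>i. C * (1 / 2) ^ i"]) auto
      moreover have "0 \<le> ?W s" by (simp add: wasserstein_def)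
      ultimately show ?thesis by simp
    qed
  qed
qed

text \<open>\<open>laws_unique_grid\<close>, with \<open>M\<close> as both sample spaces, gives
  distance 0 of the marginals. The path estimate is then used at each sample point on the given
  space, where the inputs coincide and \<open>\<epsilon> = \<sigma> = 0\<close> is allowed.\<close>

lemma pathwise_unique:
  assumes ws1: "weak_solution T p B \<mu>Y M X Y" and ws2: "weak_solution T p B \<mu>Y M X' Y"
  shows "AE \<omega> in M. X \<omega> = X' \<omega>"
proof -
  obtain q :: "nat \<Rightarrow> real" and N where q: "q 0 = 0" "q N = T" "mono q"
    "\<And>i. i < N \<Longrightarrow> integral {q i..q (Suc i)} (\<lambda>s. \<bar>h s\<bar>) \<le> 1 / 16"
    using obtain_grid by blast
  have qT: "q i \<le> T" if "i \<le> N" for i using monoD[OF q(3) that] q(2) by simp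
  have W0: "wasserstein p (law_at M X s) (law_at M X' s) = 0" if "s \<in> {0..q N}" for s
    using laws_unique_grid[OF ws1 ws2 q(1,3) qT q(4) order_refl] that by blast
  show ?thesis
    using weak_solution_path_solution[OF ws1] weak_solution_path_solution[OF ws2]
      AE_variation_le[OF T ws1] AE_variation_le[OF T ws2] AE_space
  proof eventually_elim
    case (elim \<omega>)
    obtain n1 n2 where "\<omega> \<in> variation_le T M X Y n1" "\<omega> \<in> variation_le T M X' Y n2" using elim(3,4) by blast
    then have v: "\<omega> \<in> variation_le T M X Y (max n1 n2)" "\<omega> \<in> variation_le T M X' Y (max n1 n2)"
      using incseqD[OF incseq_variation_le] by (meson max.cobounded1 max.cobounded2 subsetD)+
    have "dist (X \<omega>) (X' \<omega>) \<le> 0"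
    proof (rule CT_dist_le[OF T])
      show "X \<omega> \<in> CT T" "X' \<omega> \<in> CT T"
        by (rule measurable_CT_borelD(2)[OF weak_solutionD(2)[OF ws1] elim(5)]
            measurable_CT_borelD(2)[OF weak_solutionD(2)[OF ws2] elim(5)])+
      fix t assume t: "t \<in> {0..T}"
      have "perturbed_integral T 0 (2 * real (max n1 n2)) 0
        (\<lambda>s. B s (apply_bcontfun (X \<omega>) s) (law_at M X s) - B s (apply_bcontfun (X' \<omega>) s) (law_at M X' s))
        (\<lambda>s. apply_bcontfun (Y \<omega>) s - apply_bcontfun (Y \<omega>) s)
        (\<lambda>s. apply_bcontfun (X \<omega>) s - apply_bcontfun (X' \<omega>) s) (\<lambda>s. \<bar>h s\<bar>)"
        by (rule path_perturbed_integral[OF elim(1,2) variation_leD[OF v(1)] variation_leD[OF v(2)]]) auto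
      then have "norm (apply_bcontfun (X \<omega>) t - apply_bcontfun (X' \<omega>) t) \<le> 8 ^ N * 0"
        by (rule path_distance_grid[OF _ weak_solutionD(5)[OF ws1] weak_solutionD(5)[OF ws2] q(1,3) qT q(4) W0])
          (use t q(2) in auto)
      then show "dist (apply_bcontfun (X \<omega>) t) (apply_bcontfun (X' \<omega>) t) \<le> 0" by (simp add: dist_norm)
    qed
    then show ?case by simp
  qed
qed

text \<open>Once the marginals have distance 0 on all of \<open>{0..T}\<close>, close inputs force
  uniformly close solutions on the events of bounded variation, as \<open>closed_prob_le\<close>
  requires.\<close>

lemma closed_prob_le_weak_solutions:
  assumes ws1: "weak_solution T p B \<mu>Y M1 X1 Y1" and ws2: "weak_solution T p B \<mu>Y M2 X2 Y2"
    and F: "closed F"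
  shows "measure M1 (X1 -` F \<inter> space M1) \<le> measure M2 (X2 -` F \<inter> space M2)"
proof -
  interpret equal_inputs T M1 M2 Y1 Y2 "variation_le T M1 X1 Y1" "variation_le T M2 X2 Y2"
    "\<lambda>\<omega>. path_solution T B (law_at M1 X1) (apply_bcontfun (X1 \<omega>)) (apply_bcontfun (Y1 \<omega>))"
    "\<lambda>\<omega>. path_solution T B (law_at M2 X2) (apply_bcontfun (X2 \<omega>)) (apply_bcontfun (Y2 \<omega>))"
    by (rule equal_inputs_weak_solutions[OF T ws1 ws2])
  obtain q :: "nat \<Rightarrow> real" and N where q: "q 0 = 0" "q N = T" "mono q"
    "\<And>i. i < N \<Longrightarrow> integral {q i..q (Suc i)} (\<lambda>s. \<bar>h s\<bar>) \<le> 1 / 16"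
    using obtain_grid by blast
  have qT: "q i \<le> T" if "i \<le> N" for i using monoD[OF q(3) that] q(2) by simp
  have W0: "wasserstein p (law_at M1 X1 s) (law_at M2 X2 s) = 0" if "s \<in> {0..q N}" for s
    using laws_unique_grid[OF ws1 ws2 q(1,3) qT q(4) order_refl] that by blast
  note XC = weak_solutionD(2)[OF ws1] weak_solutionD(2)[OF ws2]
  show ?thesis
  proof (rule closed_prob_le[OF measurable_CT_borelD(1)[OF XC(1)] measurable_CT_borelD(1)[OF XC(2)] _ F])
    fix n and \<tau> :: real assume \<tau>: "0 < \<tau>"
    define \<sigma> where "\<sigma> = \<tau> / 8 ^ N"
    have \<sigma>: "0 < \<sigma>" "8 ^ N * \<sigma> = \<tau>" using \<tau> by (auto simp: \<sigma>_def)
    obtain \<epsilon> where \<epsilon>: "0 < \<epsilon>" "\<epsilon> \<le> \<sigma>" "4 * (\<epsilon> * (2 * real n)) \<le> \<sigma>\<^sup>2"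
      using exists_input_tolerance[OF \<sigma>(1), of "real n"] by auto
    have "dist (X1 \<omega>1) (X2 \<omega>2) \<le> \<tau>"
      if v: "\<omega>1 \<in> variation_le T M1 X1 Y1 n" "\<omega>2 \<in> variation_le T M2 X2 Y2 n"
        and sol: "path_solution T B (law_at M1 X1) (apply_bcontfun (X1 \<omega>1)) (apply_bcontfun (Y1 \<omega>1))"
          "path_solution T B (law_at M2 X2) (apply_bcontfun (X2 \<omega>2)) (apply_bcontfun (Y2 \<omega>2))"
        and d: "dist (Y1 \<omega>1) (Y2 \<omega>2) \<le> \<epsilon>" for \<omega>1 \<omega>2
    proof (rule CT_dist_le[OF T])
      show "X1 \<omega>1 \<in> CT T" "X2 \<omega>2 \<in> CT T"
        using v measurable_CT_borelD(2)[OF XC(1)] measurable_CT_borelD(2)[OF XC(2)] by (auto simp: variation_le_def)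
      fix t assume t: "t \<in> {0..T}"
      have "norm (apply_bcontfun (X1 \<omega>1) t - apply_bcontfun (X2 \<omega>2) t) \<le> 8 ^ N * \<sigma>"
        by (rule path_distance_grid[OF path_perturbed_integral[OF sol variation_leD[OF v(1)] variation_leD[OF v(2)] d less_imp_le[OF \<sigma>(1)] \<epsilon>(2,3)]
              weak_solutionD(5)[OF ws1] weak_solutionD(5)[OF ws2] q(1,3) qT q(4) W0]) (use t q(2) in auto)
      then show "dist (apply_bcontfun (X1 \<omega>1) t) (apply_bcontfun (X2 \<omega>2) t) \<le> \<tau>" by (simp add: dist_norm \<sigma>(2))
    qed
    then show "\<exists>\<epsilon>>0. \<forall>\<omega>1\<in>variation_le T M1 X1 Y1 n. \<forall>\<omega>2\<in>variation_le T M2 X2 Y2 n.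
        path_solution T B (law_at M1 X1) (apply_bcontfun (X1 \<omega>1)) (apply_bcontfun (Y1 \<omega>1)) \<longrightarrow>
        path_solution T B (law_at M2 X2) (apply_bcontfun (X2 \<omega>2)) (apply_bcontfun (Y2 \<omega>2)) \<longrightarrow>
        dist (Y1 \<omega>1) (Y2 \<omega>2) \<le> \<epsilon> \<longrightarrow> dist (X1 \<omega>1) (X2 \<omega>2) \<le> \<tau>"
      using \<epsilon>(1) by blast
  qed
qed

text \<open>The inequality for closed sets holds in both directions because the two solutions play
  symmetric roles.\<close>

lemma unique_in_law:
  assumes ws1: "weak_solution T p B \<mu>Y M1 X1 Y1" and ws2: "weak_solution T p B \<mu>Y M2 X2 Y2"
  shows "distr M1 (CT_borel T) X1 = distr M2 (CT_borel T) X2"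
proof (rule measure_eqI)
  note X = weak_solutionD(2)[OF ws1] weak_solutionD(2)[OF ws2]
  note Xb = measurable_CT_borelD(1)[OF X(1)] measurable_CT_borelD(1)[OF X(2)]
  have eq: "distr M1 borel X1 = distr M2 borel X2"
    using closed_prob_le_weak_solutions[OF ws1 ws2] closed_prob_le_weak_solutions[OF ws2 ws1]
    by (intro distr_borel_eqI_closed weak_solutionD(1)[OF ws1] weak_solutionD(1)[OF ws2] Xb antisym)
  fix A assume "A \<in> sets (distr M1 (CT_borel T) X1)"
  then have A: "A \<in> sets (CT_borel T)" by simp
  then obtain A' where A': "A' \<in> sets borel" "A = CT T \<inter> A'"
    by (auto simp: CT_borel_def sets_restrict_space)
  \<comment> \<open>Both solutions take values in \<open>CT T\<close>, so a trace set and the Borel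
    set it comes from have the same preimages.\<close>
  have "X1 -` A \<inter> space M1 = X1 -` A' \<inter> space M1" "X2 -` A \<inter> space M2 = X2 -` A' \<inter> space M2"
    using measurable_CT_borelD(2)[OF X(1)] measurable_CT_borelD(2)[OF X(2)] by (auto simp: A'(2))
  then show "emeasure (distr M1 (CT_borel T) X1) A = emeasure (distr M2 (CT_borel T) X2) A"
    using arg_cong[OF eq, of "\<lambda>\<mu>. emeasure \<mu> A'"] A A'(1) X Xb by (simp add: emeasure_distr)
qed simp

end

theorem proposition3p21:
  fixes T p :: real
    and B :: "real \<Rightarrow> real ^ 'd \<Rightarrow> (real ^ 'd) measure \<Rightarrow> real ^ 'd"
    and h :: "real \<Rightarrow> real"
  assumes "T > 0"
    and "p > 1"
    and "(\<lambda>(t, x, \<mu>). B t x \<mu>) \<in>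
           borel_measurable (restrict_space borel {0..T} \<Otimes>\<^sub>M borel \<Otimes>\<^sub>M Pp_borel p)"
    and "h absolutely_integrable_on {0<..<T}"
    and "\<forall>t\<in>{0..T}. \<forall>x y. \<forall>\<mu>\<in>Pp p borel. \<forall>\<nu>\<in>Pp p borel.
           (x - y) \<bullet> (B t x \<mu> - B t y \<nu>)
             \<le> h t * ((norm (x - y))\<^sup>2 + norm (x - y) * wasserstein p \<mu> \<nu>)"
  shows "\<forall>\<mu>Y \<in> Pp p (CT_borel T :: (real \<Rightarrow>\<^sub>C (real ^ 'd)) measure).
           pathwise_uniqueness TYPE('w) T p B \<mu>Y \<and>
           uniqueness_in_law TYPE('w1) TYPE('w2) T p B \<mu>Y"
proof -
  interpret monotone_drift T p B h
    using assms by unfold_locales auto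
  show ?thesis
    unfolding pathwise_uniqueness_def uniqueness_in_law_def
    by (intro ballI conjI allI impI) (rule pathwise_unique unique_in_law; erule conjunct1 conjunct2)+
qed

end
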